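(* Let $p$ be an odd prime, $m\ge 1$, $q=p^m$, let $\mathbb{F}_q$ be the field with $q$ elements, let $g$ be a generator of the cyclic group $\mathbb{F}_q^*$, and let $c\in\mathbb{F}_q$. For $n\ge 1$ let $N_n(c)=\#\{(x_1,\dots,x_n)\in\mathbb{F}_q^n : x_1^4+\cdots+x_n^4=c\}$. (i) Suppose $q\equiv 1\pmod 4$ and $c\in\mathbb{F}_q^*$. Define integers $s,t$ as follows: if $p\equiv 1\pmod 4$, then $s,t$ are the unique integers with $q=s^2+4t^2$, $\gcd(p,s)=1$, $s\equiv 1\pmod 4$ and $2t= s\,g^{3(q-1)/4}$ in $\mathbb{F}_q$ (i.e. $2t\equiv s g^{3(q-1)/4}\pmod p$); if $p\equiv 3\pmod 4$, then $s=(-p)^{m/2}$ and $t=0$. Define the polynomials $$B_1(c,x)=\begin{cases}3x-(6s+3)x^2+(-q+4s^2)x^3, & \operatorname{ind}_g(c)\equiv 0\pmod 4,\\ -x+(2s+8t-3)x^2+(-q-8st)x^3, & \operatorname{ind}_g(c)\equiv 1\pmod 4,\\ -x+(2s-3)x^2+(-q+16t^2)x^3, & \operatorname{ind}_g(c)\equiv 2\pmod 4,\\ -x+(2s-8t-3)x^2+(-q+8st)x^3, & \operatorname{ind}_g(c)\equiv 3\pmod 4,\end{cases}$$ $$B_2(c,x)=\begin{cases}3x+(2s+1)x^2+(3q-4s^2)x^3, & \operatorname{ind}_g(c)\equiv 0\pmod 4,\\ -x+(2s-8t+1)x^2+(3q+8st)x^3, & \operatorname{ind}_g(c)\equiv 1\pmod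 4,\\ -x+(-6s+1)x^2+(-5q-16t^2)x^3, & \operatorname{ind}_g(c)\equiv 2\pmod 4,\\ -x+(2s+8t+1)x^2+(3q-8st)x^3, & \operatorname{ind}_g(c)\equiv 3\pmod 4.\end{cases}$$ Then, as formal power series (equivalently, rational functions) in $x$, $$\sum_{n=1}^{\infty}N_n(c)x^n=\begin{cases}\dfrac{x}{1-qx}+\dfrac{6sx^3+(q-4s^2)x^4+B_1(c,x)}{1-6qx^2+8qsx^3+(q^2-4qs^2)x^4}, & q\equiv 1\pmod 8,\\[2ex] \dfrac{x}{1-qx}+\dfrac{6sx^3+(9q-4s^2)x^4+B_2(c,x)}{1+2qx^2+8qsx^3+(9q^2-4qs^2)x^4}, & q\equiv 5\pmod 8.\end{cases}$$ (ii) Suppose $q\equiv 3\pmod 4$. Then $$\sum_{n=1}^{\infty}N_n(c)x^n=\begin{cases}\dfrac{x}{1-qx}+\dfrac{(1-q)x^2}{1+qx^2}, & c=0,\\[1.5ex] \dfrac{x}{1-qx}+\dfrac{x+x^2}{1+qx^2}, & c\neq 0 \text{ is a square in } \mathbb{F}_q,\\[1.5ex] \dfrac{x}{1-qx}+\dfrac{-x+x^2}{1+qx^2}, & c \text{ is a non-square in } \mathbb{F}_q.\end{cases}$$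
   Context: For $c\in\mathbb{F}_q^*$, $\operatorname{ind}_g(c)$ denotes the discrete logarithm of $c$ to base $g$, i.e. the integer $i\in\{0,\dots,q-2\}$ with $g^i=c$. Integers are mapped into $\mathbb{F}_q$ via the prime subfield. *)

theory Defs
  imports
    "HOL-Computational_Algebra.Computational_Algebra"
    "HOL-Number_Theory.Cong"
    "HOL-Library.Cardinality"
    "HOL-Library.FuncSet"
begin

definition is_generator :: "'a::field \<Rightarrow> bool" where
  "is_generator g \<longleftrightarrow> g \<noteq> 0 \<and> (\<forall>y. y \<noteq> 0 \<longrightarrow> (\<exists>k::nat. y = g ^ k))"

definition ind :: "'a::{field,finite} \<Rightarrow> 'a \<Rightarrow> nat" where
  "ind g c = (THE i. i \<in> {0..CARD('a) - 2} \<and> g ^ i = c)"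

definition num_sols :: "nat \<Rightarrow> 'a::{field,finite} \<Rightarrow> nat" where
  "num_sols n c = card {x \<in> {1..n} \<rightarrow>\<^sub>E (UNIV :: 'a set). (\<Sum>i=1..n. x i ^ 4) = c}"

definition gen_fun :: "'a::{field,finite} \<Rightarrow> rat fps" where
  "gen_fun c = Abs_fps (\<lambda>n. if n = 0 then 0 else of_nat (num_sols n c))"

definition is_st :: "nat \<Rightarrow> nat \<Rightarrow> 'a::{field,finite} \<Rightarrow> int \<Rightarrow> int \<Rightarrow> bool" where
  "is_st p m g s t \<longleftrightarrow>
     (if [p = 1] (mod 4) then
        int (p ^ m) = s\<^sup>2 + 4 * t\<^sup>2 \<and> gcd (int p) s = 1 \<and> [s = 1] (mod 4) \<and>
        (of_int (2 * t) :: 'a) = of_int s * g ^ (3 * (p ^ m - 1) div 4)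
      else s = (- int p) ^ (m div 2) \<and> t = 0)"

text \<open>The coefficients are listed in order of increasing degree in \<open>x\<close>;
  \<open>r\<close> stands for \<open>ind g c\<close>.\<close>

definition B1 :: "rat \<Rightarrow> rat \<Rightarrow> rat \<Rightarrow> nat \<Rightarrow> rat poly" where
  "B1 q s t r =
     (if [r = 0] (mod 4) then [:0, 3, - (6*s + 3), - q + 4*s\<^sup>2:]
      else if [r = 1] (mod 4) then [:0, -1, 2*s + 8*t - 3, - q - 8*s*t:]
      else if [r = 2] (mod 4) then [:0, -1, 2*s - 3, - q + 16*t\<^sup>2:]
      else [:0, -1, 2*s - 8*t - 3, - q + 8*s*t:])"

definition B2 :: "rat \<Rightarrow> rat \<Rightarrow> rat \<Rightarrow> nat \<Rightarrow> rat poly" where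
  "B2 q s t r =
     (if [r = 0] (mod 4) then [:0, 3, 2*s + 1, 3*q - 4*s\<^sup>2:]
      else if [r = 1] (mod 4) then [:0, -1, 2*s - 8*t + 1, 3*q + 8*s*t:]
      else if [r = 2] (mod 4) then [:0, -1, - 6*s + 1, - 5*q - 16*t\<^sup>2:]
      else [:0, -1, 2*s + 8*t + 1, 3*q - 8*s*t:])"

text \<open>A quotient of polynomials as a power series; it is only applied to denominators
  with constant term 1, which are units in the ring of power series.\<close>

definition rat_fun :: "rat poly \<Rightarrow> rat poly \<Rightarrow> rat fps" where
  "rat_fun a b = fps_of_poly a / fps_of_poly b"

end

theory Submission
  imports Defs "HOL-Number_Theory.Residues"
begin

text \<open>
  Put \<open>f(c) = #{x. x^4 = c} - 1\<close>. As \<open>f\<close> sums to \<open>0\<close>, convolution on the additive group gives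
  \<open>N\<^sub>n = q^(n-1) + f * \<dots> * f\<close> (\<open>n\<close> factors). For \<open>q \<equiv> 1 (mod 4)\<close> one has \<open>f = \<chi> + \<chi>\<^sup>2 + \<chi>\<^sup>3\<close> with
  the quartic character \<open>\<chi>(g^k) = i^k\<close>, and convolution with \<open>f\<close> preserves the span of
  \<open>\<chi>, \<chi>\<^sup>2, \<chi>\<^sup>3\<close>, the delta function at \<open>0\<close> and the constants; all its entries are expressed by
  \<open>\<chi>(-1)\<close>, \<open>q\<close> and \<open>J = J(\<chi>, \<chi>)\<close>, since \<open>J(\<chi>\<^sup>2, \<chi>) = \<chi>(-1) J\<close>. The fourth convolution power of \<open>f\<close> is,
  up to a constant function, a combination of the lower ones, which is the linear recurrence.

  It remains to see that \<open>J = -s + 2ti\<close>. The norm of \<open>J\<close> is \<open>q\<close>, and \<open>J(\<chi>\<^sup>2, \<chi>) \<equiv> -q (mod 2 + 2i)\<close>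
  fixes the sign of \<open>s\<close>. Sending \<open>i\<close> to \<open>g^((q-1)/4)\<close> turns \<open>\<chi>(x)\<close> into \<open>x^((q-1)/4)\<close>, hence \<open>J\<close>
  into a power sum that vanishes in the field, while the conjugate of \<open>J\<close> becomes, up to sign, the
  binomial coefficient of \<open>3(q-1)/4\<close> over \<open>(q-1)/4\<close>, which is prime to \<open>p\<close> if \<open>p \<equiv> 1 (mod 4)\<close>.
  If \<open>p \<equiv> 3 (mod 4)\<close>, then \<open>p\<close> is inert in the Gaussian integers and the norm determines \<open>J\<close> up to a unit.
  For \<open>q \<equiv> 3 (mod 4)\<close>, \<open>f\<close> is the quadratic character.
\<close>

declare One_nat_def [simp del]

section \<open>Convolution and multiplicative characters of a finite field\<close>

lemma card_field_ge_2: "2 \<le> CARD('a::{field,finite})"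
proof -
  have "card {0, 1 :: 'a} \<le> CARD('a)"
    by (intro card_mono) auto
  then show ?thesis by simp
qed

lemma card_nonzero: "card (- {0 :: 'a::{field,finite}}) = CARD('a) - 1"
  by (simp add: Compl_eq_Diff_UNIV)

lemma power_card_minus_1_eq_1:
  fixes x :: "'a::{field,finite}"
  assumes "x \<noteq> 0"
  shows "x ^ (CARD('a) - 1) = 1"
proof -
  have "(\<Prod>y\<in>-{0::'a}. y) = (\<Prod>y\<in>-{0}. x * y)"
    by (rule prod.reindex_bij_witness[of _ "\<lambda>y. x * y" "\<lambda>y. y / x"]) (use assms in auto)
  also have "\<dots> = x ^ (CARD('a) - 1) * (\<Prod>y\<in>-{0}. y)"
    by (simp add: prod.distrib card_nonzero)
  finally show ?thesis
    by (simp add: prod_zero_iff)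
qed

text \<open>The translation by \<open>1\<close> permutes the field, so it leaves the sum of all
  elements unchanged although it adds \<open>1\<close> for each of them.\<close>

lemma of_nat_card_eq_0: "(of_nat CARD('a::{field,finite}) :: 'a) = 0"
proof -
  have "(\<Sum>x\<in>UNIV. x + 1 :: 'a) = (\<Sum>x\<in>UNIV. x)"
    by (rule sum.reindex_bij_witness[of _ "\<lambda>x. x - 1" "\<lambda>x. x + 1"]) auto
  then show ?thesis
    by (simp add: sum.distrib)
qed

section \<open>Convolution on the additive group\<close>

definition conv :: "('a::{field,finite} \<Rightarrow> 'b::comm_ring_1) \<Rightarrow> ('a \<Rightarrow> 'b) \<Rightarrow> 'a \<Rightarrow> 'b" where
  "conv f h c = (\<Sum>x\<in>UNIV. f x * h (c - x))"

lemma sum_UNIV_minus: "(\<Sum>x\<in>UNIV. f (c - x)) = (\<Sum>x\<in>(UNIV::'a::{field,finite} set). f x)"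
  by (rule sum.reindex_bij_witness[of _ "\<lambda>x. c - x" "\<lambda>x. c - x"]) auto

lemma sum_UNIV_times:
  "b \<noteq> 0 \<Longrightarrow> (\<Sum>x\<in>UNIV. f (b * x)) = (\<Sum>x\<in>(UNIV::'a::{field,finite} set). f x)"
  by (rule sum.reindex_bij_witness[of _ "\<lambda>x. x / b" "\<lambda>x. b * x"]) auto

lemma conv_commute: "conv f h c = conv h f c"
proof -
  have "conv f h c = (\<Sum>x\<in>UNIV. f (c - x) * h (c - (c - x)))"
    unfolding conv_def by (rule sum_UNIV_minus[symmetric])
  then show ?thesis
    by (simp add: conv_def mult.commute)
qed

lemma conv_assoc: "conv (conv f h) k c = conv f (conv h k) c"
proof -
  have "conv (conv f h) k c = (\<Sum>x\<in>UNIV. \<Sum>y\<in>UNIV. f y * h (x - y) * k (c - x))"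
    by (simp add: conv_def sum_distrib_right)
  also have "\<dots> = (\<Sum>y\<in>UNIV. \<Sum>x\<in>UNIV. f y * h (x - y) * k (c - x))"
    by (rule sum.swap)
  also have "\<dots> = (\<Sum>y\<in>UNIV. \<Sum>x\<in>UNIV. f y * h x * k (c - y - x))"
  proof (rule sum.cong[OF refl])
    fix y
    show "(\<Sum>x\<in>UNIV. f y * h (x - y) * k (c - x)) = (\<Sum>x\<in>UNIV. f y * h x * k (c - y - x))"
      by (rule sum.reindex_bij_witness[of _ "\<lambda>x. x + y" "\<lambda>x. x - y"]) auto
  qed
  also have "\<dots> = conv f (conv h k) c"
    by (simp add: conv_def sum_distrib_left mult.assoc)
  finally show ?thesis .
qed

lemma sum_conv: "(\<Sum>c\<in>UNIV. conv f h c) = (\<Sum>x\<in>UNIV. f x) * (\<Sum>x\<in>UNIV. h x)"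
proof -
  have "(\<Sum>c\<in>UNIV. conv f h c) = (\<Sum>x\<in>UNIV. \<Sum>c\<in>UNIV. f x * h (c - x))"
    unfolding conv_def by (rule sum.swap)
  also have "\<dots> = (\<Sum>x\<in>UNIV. \<Sum>c\<in>UNIV. f x * h c)"
  proof (rule sum.cong[OF refl])
    fix x
    show "(\<Sum>c\<in>UNIV. f x * h (c - x)) = (\<Sum>c\<in>UNIV. f x * h c)"
      by (rule sum.reindex_bij_witness[of _ "\<lambda>c. c + x" "\<lambda>c. c - x"]) auto
  qed
  also have "\<dots> = (\<Sum>x\<in>UNIV. f x) * (\<Sum>x\<in>UNIV. h x)"
    by (rule sum_product[symmetric])
  finally show ?thesis .
qed

text \<open>The delta function at \<open>0\<close> is the unit of convolution. Convolutions of two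
  mutually inverse characters have exactly this shape, see
  \<open>conv_mchar_inverse\<close>.\<close>

lemma conv_delta: "conv f (\<lambda>c. a * of_bool (c = 0) + b) c = a * f c + b * (\<Sum>x\<in>UNIV. f x)"
proof -
  have "conv f (\<lambda>c. a * of_bool (c = 0) + b) c
      = (\<Sum>x\<in>UNIV. (if x = c then a * f x else 0) + b * f x)"
    unfolding conv_def by (intro sum.cong refl) (auto simp: algebra_simps)
  then show ?thesis
    by (simp add: sum.distrib sum_distrib_left)
qed

lemma conv_add_right: "conv f (\<lambda>c. h c + k c) c = conv f h c + conv f k c"
  by (simp add: conv_def distrib_left sum.distrib)

lemma conv_add_left: "conv (\<lambda>c. h c + k c) f c = conv h f c + conv k f c"
  by (simp add: conv_def distrib_right sum.distrib)

lemma conv_scale_right: "conv f (\<lambda>c. a * h c) c = a * conv f h c"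
  by (simp add: conv_def sum_distrib_left mult.left_commute)

lemma conv_const_right: "conv f (\<lambda>c. a) c = a * (\<Sum>x\<in>UNIV. f x)"
  by (simp add: conv_def sum_distrib_left mult.commute)

section \<open>Discrete logarithms, multiplicative characters and power sums\<close>

locale generator =
  fixes g :: "'a::{field,finite}"
  assumes is_generator: "is_generator g"
begin

lemma gen_nonzero: "g \<noteq> 0"
  using is_generator by (simp add: is_generator_def)

lemma gen_power_card: "g ^ (CARD('a) - 1) = 1"
  by (rule power_card_minus_1_eq_1[OF gen_nonzero])

lemma power_mod_card:
  fixes z :: "'b::monoid_mult"
  assumes "z ^ (CARD('a) - 1) = 1"
  shows "z ^ (k mod (CARD('a) - 1)) = z ^ k"
proof -
  have "z ^ k = z ^ (k mod (CARD('a) - 1) + (CARD('a) - 1) * (k div (CARD('a) - 1)))"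
    by simp
  then show ?thesis
    using assms unfolding power_add power_mult by simp
qed

lemma bij_betw_power: "bij_betw ((^) g) {..<CARD('a) - 1} (- {0})"
proof -
  have img: "(^) g ` {..<CARD('a) - 1} = - {0}"
  proof (intro equalityI subsetI)
    fix y :: 'a assume "y \<in> - {0}"
    then obtain k where "y = g ^ k"
      using is_generator by (auto simp: is_generator_def)
    then have "y = g ^ (k mod (CARD('a) - 1))"
      by (simp add: power_mod_card[OF gen_power_card])
    moreover have "k mod (CARD('a) - 1) < CARD('a) - 1"
      using card_field_ge_2[where 'a = 'a] by simp
    ultimately show "y \<in> (^) g ` {..<CARD('a) - 1}"
      by blast
  qed (use gen_nonzero in auto)
  \<comment> \<open>A surjection between finite sets of equal size is injective; both have
    \<open>CARD('a) - 1\<close> elements.\<close>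
  moreover have "inj_on ((^) g) {..<CARD('a) - 1}"
    by (rule eq_card_imp_inj_on) (simp_all add: img card_nonzero)
  ultimately show ?thesis
    by (simp add: bij_betw_def)
qed

lemma gen_power_eq_iff:
  "a < CARD('a) - 1 \<Longrightarrow> b < CARD('a) - 1 \<Longrightarrow> g ^ a = g ^ b \<longleftrightarrow> a = b"
  using bij_betw_power by (auto simp: bij_betw_def inj_on_def)

text \<open>Makes the definite description in \<open>ind\<close> well defined.\<close>

lemma ind_ex1:
  assumes "x \<noteq> 0"
  shows "\<exists>!i. i \<in> {0..CARD('a) - 2} \<and> g ^ i = x"
proof -
  have *: "i \<in> {0..CARD('a) - 2} \<longleftrightarrow> i < CARD('a) - 1" for i
    using card_field_ge_2[where 'a = 'a] by auto
  have "x \<in> (^) g ` {..<CARD('a) - 1}"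
    using assms bij_betw_power by (auto simp: bij_betw_def)
  then obtain i where "i < CARD('a) - 1" "x = g ^ i"
    by auto
  then show ?thesis
    unfolding * using gen_power_eq_iff by (intro ex1I[of _ i]) auto
qed

lemma gen_power_ind: "x \<noteq> 0 \<Longrightarrow> g ^ ind g x = x"
  using theI'[OF ind_ex1[of x]] by (simp add: ind_def)

lemma ind_less: "x \<noteq> 0 \<Longrightarrow> ind g x < CARD('a) - 1"
  using theI'[OF ind_ex1[of x]] card_field_ge_2[where 'a = 'a]
  unfolding ind_def[symmetric] by auto

lemma ind_gen_power: "ind g (g ^ k) = k mod (CARD('a) - 1)"
proof -
  have "g ^ ind g (g ^ k) = g ^ (k mod (CARD('a) - 1))"
    by (simp add: gen_power_ind gen_nonzero power_mod_card[OF gen_power_card])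
  then show ?thesis
    using gen_power_eq_iff[of "ind g (g ^ k)"] ind_less[of "g ^ k"] gen_nonzero
      card_field_ge_2[where 'a = 'a] by simp
qed

text \<open>The character with \<open>g \<mapsto> z\<close>, multiplicative only if \<open>z^(q-1) = 1\<close>. Its values lie in an
  arbitrary ring, so that one Jacobi sum can be read both in the complex numbers and in the field
  \<open>'a\<close> itself.\<close>

definition mchar :: "'b::comm_ring_1 \<Rightarrow> 'a \<Rightarrow> 'b" where
  "mchar z x = (if x = 0 then 0 else z ^ ind g x)"

lemma mchar_0 [simp]: "mchar z 0 = 0"
  by (simp add: mchar_def)

lemma mchar_gen_power:
  "z ^ (CARD('a) - 1) = 1 \<Longrightarrow> mchar z (g ^ k) = z ^ k"
  by (simp add: mchar_def gen_nonzero ind_gen_power power_mod_card)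

lemma mchar_1 [simp]: "z ^ (CARD('a) - 1) = 1 \<Longrightarrow> mchar z 1 = 1"
  using mchar_gen_power[of z 0] by simp

lemma mchar_mult:
  assumes "z ^ (CARD('a) - 1) = 1"
  shows "mchar z (x * y) = mchar z x * mchar z y"
proof (cases "x = 0 \<or> y = 0")
  case False
  then have "mchar z (x * y) = mchar z (g ^ (ind g x + ind g y))"
    by (simp add: power_add gen_power_ind)
  also have "\<dots> = mchar z x * mchar z y"
    using False unfolding mchar_gen_power[OF assms] by (simp add: mchar_def power_add)
  finally show ?thesis .
qed auto

lemma mchar_square: "z ^ (CARD('a) - 1) = 1 \<Longrightarrow> mchar z (x\<^sup>2) = mchar (z\<^sup>2) x"
  by (simp add: power2_eq_square mchar_mult) (simp add: mchar_def power_mult_distrib)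

lemma mchar_mult_base: "mchar z x * mchar w x = mchar (z * w) x"
  by (simp add: mchar_def power_mult_distrib)

lemma mchar_one: "mchar 1 x = (if x = 0 then 0 else 1)"
  by (simp add: mchar_def)

text \<open>Substituting \<open>g * x\<close> for \<open>x\<close> multiplies the sum by
  \<open>z\<close>, which differs from \<open>1\<close>.\<close>

lemma sum_mchar:
  fixes z :: "'b::idom"
  assumes "z ^ (CARD('a) - 1) = 1" "z \<noteq> 1"
  shows "(\<Sum>x\<in>UNIV. mchar z x) = 0"
proof -
  have "(\<Sum>x\<in>UNIV. mchar z x) = (\<Sum>x\<in>UNIV. mchar z (g * x))"
    using sum_UNIV_times[OF gen_nonzero, of "mchar z"] by simp
  also have "\<dots> = z * (\<Sum>x\<in>UNIV. mchar z x)"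
    using mchar_gen_power[OF assms(1), of 1] by (simp add: mchar_mult[OF assms(1)] sum_distrib_left)
  finally show ?thesis
    using assms(2) by simp
qed

lemma sum_mchar_one: "(\<Sum>x\<in>UNIV. mchar 1 x) = of_nat CARD('a) - 1"
proof -
  have "(\<Sum>x\<in>UNIV. mchar 1 x) = (\<Sum>x\<in>- {0 :: 'a}. 1)"
    by (rule sum.mono_neutral_cong_right) (auto simp: mchar_one)
  then show ?thesis
    using card_field_ge_2[where 'a = 'a] by (simp add: card_nonzero of_nat_diff)
qed

text \<open>Characters with values in the field itself are power maps. Positivity of
  \<open>k\<close> matters at \<open>x = 0\<close>, where \<open>0 ^ 0\<close> would be
  \<open>1\<close>.\<close>

lemma mchar_gen_power_base:
  assumes "0 < k"
  shows "mchar (g ^ k) x = x ^ k"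
  using assms gen_power_ind[of x]
  by (auto simp: mchar_def simp flip: power_mult) (metis mult.commute power_mult)

text \<open>A power sum is a character sum with values in the field, and the trivial character sums
  to \<open>q - 1 = -1\<close> there.\<close>

lemma sum_power:
  assumes "0 < k"
  shows "(\<Sum>x\<in>UNIV. x ^ k :: 'a) = (if (CARD('a) - 1) dvd k then -1 else 0)"
proof -
  have gk: "(g ^ k) ^ (CARD('a) - 1) = 1"
    using gen_power_card by (metis power_commutes power_mult power_one mult.commute)
  have sum_eq: "(\<Sum>x\<in>UNIV. x ^ k :: 'a) = (\<Sum>x\<in>UNIV. mchar (g ^ k) x)"
    by (intro sum.cong refl mchar_gen_power_base[OF assms, symmetric])
  show ?thesis
  proof (cases "(CARD('a) - 1) dvd k")
    case True
    then have "g ^ k = 1"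
      using power_mod_card[OF gen_power_card, of k] by simp
    then show ?thesis
      using True by (simp add: sum_eq sum_mchar_one of_nat_card_eq_0)
  next
    case False
    have "g ^ k \<noteq> 1"
      using False ind_gen_power[of k] ind_gen_power[of 0] by (auto simp: mod_eq_0_iff_dvd)
    then show ?thesis
      using False sum_mchar[OF gk] by (simp add: sum_eq)
  qed
qed

section \<open>Jacobi sums and convolutions of two characters\<close>

definition jacobi :: "'b::comm_ring_1 \<Rightarrow> 'b \<Rightarrow> 'b" where
  "jacobi z w = (\<Sum>x\<in>UNIV. mchar z x * mchar w (1 - x))"

text \<open>Replacing \<open>x\<close> by \<open>c * x\<close> pulls \<open>c\<close> out of both
  characters and leaves the Jacobi sum.\<close>

lemma conv_mchar_nonzero:
  assumes "z ^ (CARD('a) - 1) = 1" "w ^ (CARD('a) - 1) = 1" "c \<noteq> 0"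
  shows "conv (mchar z) (mchar w) c = jacobi z w * mchar (z * w) c"
proof -
  have "conv (mchar z) (mchar w) c = (\<Sum>x\<in>UNIV. mchar z (c * x) * mchar w (c - c * x))"
    unfolding conv_def by (rule sum_UNIV_times[OF assms(3), symmetric])
  also have "\<dots> = (\<Sum>x\<in>UNIV. mchar z c * mchar w c * (mchar z x * mchar w (1 - x)))"
    using mchar_mult[OF assms(2), of c "1 - _"]
    by (intro sum.cong refl) (simp add: mchar_mult[OF assms(1)] algebra_simps)
  finally show ?thesis
    by (simp add: jacobi_def mchar_mult_base flip: sum_distrib_left)
qed

lemma conv_mchar_0:
  assumes "w ^ (CARD('a) - 1) = 1"
  shows "conv (mchar z) (mchar w) 0 = mchar w (-1) * (\<Sum>x\<in>UNIV. mchar (z * w) x)"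
proof -
  have "mchar z x * mchar w (0 - x) = mchar w (-1) * (mchar z x * mchar w x)" for x
    using mchar_mult[OF assms, of "-1" x] by (simp add: mult.left_commute)
  then have "conv (mchar z) (mchar w) 0 = (\<Sum>x\<in>UNIV. mchar w (-1) * (mchar z x * mchar w x))"
    unfolding conv_def by (intro sum.cong refl)
  then show ?thesis
    by (simp add: mchar_mult_base flip: sum_distrib_left)
qed

lemma conv_mchar:
  fixes z w :: "'b::idom"
  assumes "z ^ (CARD('a) - 1) = 1" "w ^ (CARD('a) - 1) = 1" "z * w \<noteq> 1"
  shows "conv (mchar z) (mchar w) = (\<lambda>c. jacobi z w * mchar (z * w) c)"
proof
  fix c
  show "conv (mchar z) (mchar w) c = jacobi z w * mchar (z * w) c"
  proof (cases "c = 0")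
    case True
    have "(z * w) ^ (CARD('a) - 1) = 1"
      using assms by (simp add: power_mult_distrib)
    with True show ?thesis
      using conv_mchar_0[OF assms(2), of z] sum_mchar[of "z * w"] assms(3) by simp
  qed (use conv_mchar_nonzero assms in blast)
qed

text \<open>Away from \<open>0\<close> the convolution is the constant \<open>jacobi z w\<close>.
  Its total is \<open>0\<close>, since \<open>mchar z\<close> sums to \<open>0\<close>, and its
  value at \<open>0\<close> is known; this determines the constant.\<close>

lemma conv_mchar_inverse:
  fixes z w :: "'b::field_char_0"
  assumes "z ^ (CARD('a) - 1) = 1" "z * w = 1" "z \<noteq> 1"
  shows "conv (mchar z) (mchar w) = (\<lambda>c. mchar w (-1) * (of_nat CARD('a) * of_bool (c = 0) - 1))"
proof
  fix c
  have w: "w ^ (CARD('a) - 1) = 1"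
    using assms by (metis mult_1 power_mult_distrib power_one)
  have c0: "conv (mchar z) (mchar w) 0 = mchar w (-1) * (of_nat CARD('a) - 1)"
    by (simp add: conv_mchar_0[OF w] assms sum_mchar_one)
  have cnz: "conv (mchar z) (mchar w) c = jacobi z w" if "c \<noteq> 0" for c
    using conv_mchar_nonzero[OF assms(1) w that] that by (simp add: assms mchar_one)
  have "0 = (\<Sum>c\<in>UNIV. conv (mchar z) (mchar w) c)"
    by (simp add: sum_conv sum_mchar[OF assms(1,3)])
  also have "\<dots> = conv (mchar z) (mchar w) 0 + (\<Sum>c\<in>UNIV - {0}. conv (mchar z) (mchar w) c)"
    by (rule sum.remove) auto
  also have "(\<Sum>c\<in>UNIV - {0}. conv (mchar z) (mchar w) c) = (\<Sum>c\<in>UNIV - {0 :: 'a}. jacobi z w)"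
    by (intro sum.cong refl) (simp add: cnz)
  also have "\<dots> = (of_nat CARD('a) - 1) * jacobi z w"
    using card_field_ge_2[where 'a = 'a] by (simp add: of_nat_diff)
  finally have "(of_nat CARD('a) - 1) * (mchar w (-1) + jacobi z w) = 0"
    unfolding c0 distrib_left by (simp add: mult.commute[of "mchar w (-1)"])
  moreover have "(of_nat CARD('a) - 1 :: 'b) \<noteq> 0"
    using card_field_ge_2[where 'a = 'a] of_nat_eq_1_iff[where 'a = 'b, of "CARD('a)"]
    by (simp del: of_nat_eq_1_iff)
  ultimately have "jacobi z w = - mchar w (-1)"
    by (simp add: eq_neg_iff_add_eq_0 add.commute[of "mchar w (-1)"])
  then show "conv (mchar z) (mchar w) c = mchar w (-1) * (of_nat CARD('a) * of_bool (c = 0) - 1)"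
    using c0 cnz by (cases "c = 0") auto
qed

end

section \<open>Fourth powers and the quartic Jacobi sum\<close>

context generator
begin

lemma two_neq_0: "odd CARD('a) \<Longrightarrow> (2 :: 'a) \<noteq> 0"
proof
  assume "odd CARD('a)" "(2 :: 'a) = 0"
  moreover from \<open>odd CARD('a)\<close> obtain k where "CARD('a) = 2 * k + 1"
    by (elim oddE)
  ultimately have "(of_nat CARD('a) :: 'a) = 1"
    by simp
  then show False
    by (simp add: of_nat_card_eq_0)
qed

text \<open>A nonzero \<open>w\<close> is a square iff its index is even; parity survives reduction
  modulo \<open>q - 1\<close> because \<open>q - 1\<close> is even. The roots are then
  \<open>y\<close> and \<open>- y\<close>.\<close>

lemma of_nat_card_sqrt:
  assumes "odd CARD('a)"
  shows "of_nat (card {x. x\<^sup>2 = w}) = 1 + mchar (-1) w"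
proof (cases "w = 0")
  case False
  show ?thesis
  proof (cases "even (ind g w)")
    case True
    define y where "y = g ^ (ind g w div 2)"
    have y: "y\<^sup>2 = w"
      using True gen_power_ind[OF False] by (simp add: y_def flip: power_mult)
    have "y \<noteq> - y"
      using two_neq_0[OF assms] False y by (auto simp: eq_neg_iff_add_eq_0 simp flip: mult_2)
    moreover have "{x. x\<^sup>2 = w} = {y, - y}"
      using power2_eq_iff[of _ y] by (auto simp flip: y)
    ultimately show ?thesis
      using True False by (simp add: mchar_def)
  next
    case odd_ind: False
    have "x\<^sup>2 \<noteq> w" for x
    proof
      assume x: "x\<^sup>2 = w"
      then have "w = g ^ (ind g x * 2)"
        using False gen_power_ind[of x] by (auto simp: power_mult)
      then have "ind g w = (ind g x * 2) mod (CARD('a) - 1)"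
        by (simp only: ind_gen_power)
      then show False
        using odd_ind assms by (simp add: dvd_mod_iff)
    qed
    then show ?thesis
      using odd_ind False by (simp add: mchar_def)
  qed
qed simp

lemma sum_comp_square:
  assumes "odd CARD('a)"
  shows "(\<Sum>x\<in>UNIV. h (x\<^sup>2)) = (\<Sum>w\<in>UNIV. (1 + mchar (-1) w) * h w)"
proof -
  have "(\<Sum>x\<in>UNIV. h (x\<^sup>2)) = (\<Sum>w\<in>UNIV. \<Sum>x | x\<^sup>2 = w. h (x\<^sup>2))"
    using sum.group[of UNIV UNIV "\<lambda>x. x\<^sup>2" "\<lambda>x. h (x\<^sup>2)"] by simp
  also have "\<dots> = (\<Sum>w\<in>UNIV. \<Sum>x | x\<^sup>2 = w. h w)"
    by (intro sum.cong) auto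
  finally show ?thesis
    by (simp add: of_nat_card_sqrt[OF assms])
qed

lemma gen_power_half:
  assumes "odd CARD('a)"
  shows "g ^ ((CARD('a) - 1) div 2) = -1"
proof -
  let ?h = "(CARD('a) - 1) div 2"
  have "CARD('a) \<noteq> 2"
    using assms by auto
  then have "CARD('a) \<ge> 3"
    using card_field_ge_2[where 'a = 'a] by linarith
  then have "?h < CARD('a) - 1" "0 < ?h"
    by auto
  then have "g ^ ?h \<noteq> 1"
    using gen_power_eq_iff[of ?h 0] by auto
  moreover have "(g ^ ?h)\<^sup>2 = 1"
    using assms gen_power_card by (simp flip: power_mult)
  ultimately show ?thesis
    by (simp add: power2_eq_1_iff)
qed

lemma mchar_minus_1:
  assumes "odd CARD('a)" "z ^ (CARD('a) - 1) = 1"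
  shows "mchar z (-1) = z ^ ((CARD('a) - 1) div 2)"
  using mchar_gen_power[OF assms(2), of "(CARD('a) - 1) div 2"] gen_power_half[OF assms(1)] by simp

text \<open>Here \<open>-1\<close> is a non-square, so negation flips the quadratic character but
  fixes \<open>w^2\<close>. The mixed sum cancels, and every element has as many fourth roots as
  square roots.\<close>

lemma sum_comp_fourth_3_mod_4:
  fixes h :: "'a \<Rightarrow> 'b::field_char_0"
  assumes "[CARD('a) = 3] (mod 4)"
  shows "(\<Sum>x\<in>UNIV. h (x ^ 4)) = (\<Sum>w\<in>UNIV. (1 + mchar (-1) w) * h w)"
proof -
  have odd: "odd CARD('a)" and half: "odd ((CARD('a) - 1) div 2)"
    using assms by (simp_all add: cong_def) presburger+
  have m1: "(-1 :: 'b) ^ (CARD('a) - 1) = 1"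
    using odd by simp
  have "mchar (-1 :: 'b) (- w) = - mchar (-1) w" for w
    using mchar_mult[OF m1, of "-1" w] half by (simp add: mchar_minus_1[OF odd m1])
  then have "(\<Sum>w\<in>UNIV. mchar (-1) w * h (w\<^sup>2)) = - (\<Sum>w\<in>UNIV. mchar (-1) w * h (w\<^sup>2))"
    using sum_UNIV_times[of "-1" "\<lambda>w. mchar (-1) w * h (w\<^sup>2)"] by (simp add: sum_negf)
  then have 0: "(\<Sum>w\<in>UNIV. mchar (-1) w * h (w\<^sup>2)) = 0"
    by simp
  have "(\<Sum>x\<in>UNIV. h (x ^ 4)) = (\<Sum>x\<in>UNIV. h ((x\<^sup>2)\<^sup>2))"
    by (simp flip: power_mult)
  also have "\<dots> = (\<Sum>w\<in>UNIV. (1 + mchar (-1) w) * h (w\<^sup>2))"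
    by (rule sum_comp_square[OF odd, of "\<lambda>w. h (w\<^sup>2)"])
  also have "\<dots> = (\<Sum>w\<in>UNIV. h (w\<^sup>2))"
    by (simp add: distrib_right sum.distrib 0)
  also have "\<dots> = (\<Sum>w\<in>UNIV. (1 + mchar (-1) w) * h w)"
    by (rule sum_comp_square[OF odd])
  finally show ?thesis .
qed

text \<open>Square roots are counted twice in succession; the product of \<open>1 + \<chi>^2\<close>
  and \<open>1 + \<chi>\<close> expands to the sum of all four powers of the quartic
  character.\<close>

lemma sum_comp_fourth_1_mod_4:
  fixes z :: "'b::comm_ring_1"
  assumes "[CARD('a) = 1] (mod 4)" "z\<^sup>2 = -1"
  shows "(\<Sum>x\<in>UNIV. h (x ^ 4)) =
    (\<Sum>w\<in>UNIV. h w) + (\<Sum>w\<in>UNIV. (mchar z w + mchar (-1) w + mchar (- z) w) * h w)"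
proof -
  have odd: "odd CARD('a)" and "4 dvd CARD('a) - 1"
    using assms(1) card_field_ge_2[where 'a = 'a] by (simp_all add: cong_def) presburger+
  then obtain k where k: "CARD('a) - 1 = 4 * k"
    by blast
  have "z ^ 4 = 1"
    using assms(2) power_mult[of z 2 2] by simp
  then have z: "z ^ (CARD('a) - 1) = 1"
    unfolding k power_mult by simp
  have "(\<Sum>x\<in>UNIV. h (x ^ 4)) = (\<Sum>x\<in>UNIV. h ((x\<^sup>2)\<^sup>2))"
    by (simp flip: power_mult)
  also have "\<dots> = (\<Sum>w\<in>UNIV. (1 + mchar (-1) w) * h (w\<^sup>2))"
    by (rule sum_comp_square[OF odd, of "\<lambda>w. h (w\<^sup>2)"])
  \<comment> \<open>The quadratic character at \<open>w\<close> is the quartic one at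
    \<open>w^2\<close>, so the summand depends on \<open>w\<close> only through its square.\<close>
  also have "\<dots> = (\<Sum>w\<in>UNIV. (1 + mchar z (w\<^sup>2)) * h (w\<^sup>2))"
    by (simp add: mchar_square[OF z] assms(2))
  also have "\<dots> = (\<Sum>w\<in>UNIV. (1 + mchar (-1) w) * ((1 + mchar z w) * h w))"
    by (rule sum_comp_square[OF odd, of "\<lambda>w. (1 + mchar z w) * h w"])
  also have "\<dots> = (\<Sum>w\<in>UNIV. h w + (mchar z w + mchar (-1) w + mchar (- z) w) * h w)"
  proof (rule sum.cong[OF refl])
    fix w
    have "mchar (- z) w = mchar (-1) w * mchar z w"
      by (simp add: mchar_mult_base)
    then show "(1 + mchar (-1) w) * ((1 + mchar z w) * h w) =
        h w + (mchar z w + mchar (-1) w + mchar (- z) w) * h w"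
      by (simp add: algebra_simps)
  qed
  finally show ?thesis
    by (simp add: sum.distrib)
qed

end

section \<open>The quartic character and the norm of its Jacobi sum\<close>

locale generator_1_mod_4 = generator +
  assumes card_cong: "[CARD('a) = 1] (mod 4)"
begin

lemma odd_card: "odd CARD('a)"
  using card_cong by (simp add: cong_def) presburger

lemma four_dvd: "4 dvd CARD('a) - 1"
  using card_cong card_field_ge_2[where 'a = 'a] by (simp add: cong_def) presburger

lemma root_power_card:
  fixes z :: "'b::comm_ring_1"
  assumes "z\<^sup>2 = -1"
  shows "z ^ (CARD('a) - 1) = 1" "(- z) ^ (CARD('a) - 1) = 1" "(-1 :: 'b) ^ (CARD('a) - 1) = 1"
proof -
  have *: "y ^ (CARD('a) - 1) = 1" if "y ^ 4 = 1" for y :: 'b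
    using four_dvd that by (metis dvdE power_mult power_one)
  have "z ^ 4 = 1"
    using assms power_mult[of z 2 2] by simp
  then show "z ^ (CARD('a) - 1) = 1" "(- z) ^ (CARD('a) - 1) = 1" "(-1 :: 'b) ^ (CARD('a) - 1) = 1"
    by (simp_all add: *)
qed

lemma mchar_minus_1_root:
  fixes z :: "'b::comm_ring_1"
  assumes "z\<^sup>2 = -1"
  shows "mchar z (-1) = (-1) ^ ((CARD('a) - 1) div 4)" "mchar (- z) (-1) = mchar z (-1)"
    "mchar (-1 :: 'b) (-1) = 1"
proof -
  have half: "(CARD('a) - 1) div 2 = 2 * ((CARD('a) - 1) div 4)"
    using four_dvd by auto
  show "mchar z (-1) = (-1) ^ ((CARD('a) - 1) div 4)" "mchar (- z) (-1) = mchar z (-1)"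
    "mchar (-1 :: 'b) (-1) = 1"
    using assms root_power_card[OF assms] odd_card by (simp_all add: mchar_minus_1 half power_mult)
qed

text \<open>This element plays the role of the imaginary unit inside the field.\<close>

lemma gen_root: "(g ^ ((CARD('a) - 1) div 4))\<^sup>2 = -1"
proof -
  have "(CARD('a) - 1) div 4 * 2 = (CARD('a) - 1) div 2"
    using four_dvd by auto
  then show ?thesis
    using gen_power_half[OF odd_card] by (simp flip: power_mult)
qed

text \<open>With \<open>?w^2 = -1\<close> one has \<open>-4 = (1 + ?w)^4\<close>, so the quartic
  character is \<open>1\<close> at \<open>-4\<close>.\<close>

lemma mchar_4:
  fixes z :: "'b::comm_ring_1"
  assumes "z\<^sup>2 = -1"
  shows "mchar z 4 = mchar z (-1)"
proof -
  note z = root_power_card(1)[OF assms]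
  let ?w = "g ^ ((CARD('a) - 1) div 4)"
  have "(1 + ?w)\<^sup>2 = 2 * ?w"
    using gen_root by (simp add: power2_sum)
  then have w: "((1 + ?w)\<^sup>2)\<^sup>2 = -4"
    using gen_root by (simp add: power_mult_distrib)
  have "(4 :: 'a) \<noteq> 0"
    using two_neq_0[OF odd_card] by (metis mult_2 mult_eq_0_iff numeral_Bit0)
  then have nz: "1 + ?w \<noteq> 0"
    using w by auto
  have "mchar z (-4) = mchar ((z\<^sup>2)\<^sup>2) (1 + ?w)"
    unfolding w[symmetric] assms mchar_square[OF z] by (rule mchar_square[OF root_power_card(3)[OF assms]])
  also have "\<dots> = 1"
    using nz assms by (simp add: mchar_one)
  finally show ?thesis
    using mchar_mult[OF z, of "-1" "-4"] by simp
qed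

lemma jacobi_eq_sum:
  fixes z :: "'b::comm_ring_1"
  assumes "z\<^sup>2 = -1"
  shows "jacobi z z = (\<Sum>x\<in>UNIV. mchar z (x * (1 - x)))"
  by (simp add: jacobi_def mchar_mult root_power_card[OF assms])

text \<open>Completing the square, \<open>4x(1 - x) = 1 - (2x - 1)\<^sup>2\<close>.\<close>

lemma jacobi_diag:
  fixes z :: "'b::field_char_0"
  assumes "z\<^sup>2 = -1"
  shows "jacobi z z = mchar z (-1) * jacobi (-1) z"
proof -
  note z = root_power_card[OF assms]
  have z1: "z \<noteq> 1"
    using assms by auto
  have "mchar z (-1) * jacobi z z = (\<Sum>x\<in>UNIV. mchar z (4 * (x * (1 - x))))"
    by (simp add: jacobi_eq_sum[OF assms] mchar_mult[OF z(1)] mchar_4[OF assms] sum_distrib_left)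
  also have "\<dots> = (\<Sum>y\<in>UNIV. mchar z (1 - y\<^sup>2))"
    using two_neq_0[OF odd_card]
    by (intro sum.reindex_bij_witness[of _ "\<lambda>y. (y + 1) / 2" "\<lambda>x. 2 * x - 1"])
      (auto simp: power2_eq_square algebra_simps)
  also have "\<dots> = (\<Sum>w\<in>UNIV. (1 + mchar (-1) w) * mchar z (1 - w))"
    by (rule sum_comp_square[OF odd_card])
  \<comment> \<open>The summand \<open>1\<close> contributes a full character sum, which
    vanishes.\<close>
  also have "\<dots> = jacobi (-1) z"
    using sum_UNIV_minus[of "mchar z" 1] sum_mchar[OF z(1) z1]
    by (simp add: distrib_right sum.distrib jacobi_def)
  finally have "jacobi (-1) z = mchar z (-1) * jacobi z z" ..
  then show ?thesis
    using mchar_mult[OF z(1), of "-1" "-1"] z(1) by (simp flip: mult.assoc)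
qed

text \<open>The triple convolution of \<open>\<chi>\<close>, \<open>\<chi>\<close> and the inverse
  of \<open>\<chi>\<close> at \<open>1\<close> is evaluated with both bracketings: one gives
  \<open>\<chi>(-1)\<close> times the norm, the other \<open>\<chi>(-1) q\<close>.\<close>

lemma jacobi_norm:
  fixes z :: "'b::field_char_0"
  assumes "z\<^sup>2 = -1"
  shows "jacobi z z * jacobi (- z) (- z) = of_nat CARD('a)"
proof -
  note z = root_power_card[OF assms]
  have nz: "z \<noteq> 1" "z * z = -1" "(-1 :: 'b) \<noteq> 1" "z * - z = 1"
    using assms by (auto simp: power2_eq_square)
  have e: "mchar z (-1) * mchar z (-1) = 1"
    using mchar_mult[OF z(1), of "-1" "-1"] z(1) by simp
  have "conv (conv (mchar z) (mchar z)) (mchar (- z)) 1 = jacobi z z * conv (mchar (-1)) (mchar (- z)) 1"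
    by (simp add: conv_mchar[OF z(1) z(1)] nz) (simp add: conv_def sum_distrib_left mult.assoc)
  also have "\<dots> = jacobi z z * jacobi (-1) (- z)"
    using conv_mchar[OF z(3) z(2)] nz z by simp
  also have "jacobi (-1) (- z) = mchar z (-1) * jacobi (- z) (- z)"
    using jacobi_diag[of "- z"] assms e by (simp add: mchar_minus_1_root(2)[OF assms] flip: mult.assoc)
  finally have 1: "conv (conv (mchar z) (mchar z)) (mchar (- z)) 1
      = mchar z (-1) * (jacobi z z * jacobi (- z) (- z))"
    by simp
  have "conv (mchar z) (mchar (- z)) =
      (\<lambda>c. mchar z (-1) * of_nat CARD('a) * of_bool (c = 0) + - mchar z (-1))"
    using conv_mchar_inverse[OF z(1) nz(4,1)]
    by (simp add: mchar_minus_1_root(2)[OF assms] algebra_simps)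
  then have "conv (mchar z) (conv (mchar z) (mchar (- z))) 1 = mchar z (-1) * of_nat CARD('a)"
    using z(1) nz(1) by (simp only: conv_delta) (simp add: sum_mchar)
  with 1 have "mchar z (-1) * (mchar z (-1) * (jacobi z z * jacobi (- z) (- z)))
      = mchar z (-1) * (mchar z (-1) * of_nat CARD('a))"
    by (simp only: conv_assoc)
  then show ?thesis
    by (simp only: e mult_1 flip: mult.assoc)
qed

end

section \<open>The Jacobi sum modulo 2 + 2i\<close>

text \<open>Together with \<open>quarter_sin\<close>, the integer coordinates of the powers of a
  square root of \<open>-1\<close>.\<close>

definition quarter_cos :: "nat \<Rightarrow> int" where
  "quarter_cos n = (if n mod 4 = 0 then 1 else if n mod 4 = 2 then -1 else 0)"

definition quarter_sin :: "nat \<Rightarrow> int" where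
  "quarter_sin n = (if n mod 4 = 1 then 1 else if n mod 4 = 3 then -1 else 0)"

lemma power_root_eq:
  fixes z :: "'b::comm_ring_1"
  assumes "z\<^sup>2 = -1"
  shows "z ^ n = of_int (quarter_cos n) + of_int (quarter_sin n) * z"
proof -
  have z4: "z ^ 4 = 1"
    using assms power_mult[of z 2 2] by simp
  have z3: "z ^ 3 = - z"
    using assms by (simp add: power3_eq_cube power2_eq_square)
  have "z ^ n = z ^ (4 * (n div 4) + n mod 4)"
    by simp
  also have "\<dots> = z ^ (n mod 4)"
    unfolding power_add power_mult z4 by simp
  finally have *: "z ^ n = z ^ (n mod 4)" .
  have "n mod 4 \<in> {0, 1, 2, 3}"
    by auto
  then show ?thesis
    unfolding * quarter_cos_def quarter_sin_def using assms z3 by auto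
qed

context generator_1_mod_4
begin

definition char_re :: "'a \<Rightarrow> int" where
  "char_re x = (if x = 0 then 0 else quarter_cos (ind g x))"

definition char_im :: "'a \<Rightarrow> int" where
  "char_im x = (if x = 0 then 0 else quarter_sin (ind g x))"

lemma mchar_root_eq:
  fixes z :: "'b::comm_ring_1"
  assumes "z\<^sup>2 = -1"
  shows "mchar z x = of_int (char_re x) + of_int (char_im x) * z"
  by (simp add: mchar_def char_re_def char_im_def power_root_eq[OF assms])

lemma mchar_minus_1_of_int: "mchar (-1) x = of_int (mchar (-1) x)"
  by (simp add: mchar_def)

definition jacobi_re :: int where
  "jacobi_re = (\<Sum>x\<in>UNIV. char_re (x * (1 - x)))"

definition jacobi_im :: int where
  "jacobi_im = (\<Sum>x\<in>UNIV. char_im (x * (1 - x)))"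

text \<open>The same two integers serve for every square root \<open>z\<close> of \<open>-1\<close>,
  complex or in the finite field. This transfers information between the two readings without
  reducing modulo a Gaussian prime.\<close>

lemma jacobi_root_eq:
  fixes z :: "'b::comm_ring_1"
  assumes "z\<^sup>2 = -1"
  shows "jacobi z z = of_int jacobi_re + of_int jacobi_im * z"
  by (simp add: jacobi_eq_sum[OF assms] mchar_root_eq[OF assms] jacobi_re_def jacobi_im_def
      sum.distrib sum_distrib_right)

lemma complex_of_int_eq_iff:
  "of_int a + of_int b * \<i> = of_int c + of_int d * \<i> \<longleftrightarrow> a = c \<and> b = d"
  by (auto simp: complex_eq_iff)

lemma jacobi_re_im_norm: "jacobi_re\<^sup>2 + jacobi_im\<^sup>2 = int CARD('a)"
proof -
  have i: "\<i>\<^sup>2 = -1" "(- \<i>)\<^sup>2 = -1"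
    by auto
  have "of_int (jacobi_re\<^sup>2 + jacobi_im\<^sup>2) = (of_nat CARD('a) :: complex)"
    using jacobi_norm[OF i(1)] unfolding jacobi_root_eq[OF i(1)] jacobi_root_eq[OF i(2)]
    by (simp add: algebra_simps power2_eq_square)
  then show ?thesis
    by (metis of_int_eq_iff of_int_of_nat_eq)
qed

lemma sum_char_re: "(\<Sum>x\<in>UNIV. char_re x) = 0"
  and sum_char_im: "(\<Sum>x\<in>UNIV. char_im x) = 0"
proof -
  have i: "\<i>\<^sup>2 = -1"
    by simp
  have "(\<Sum>x\<in>UNIV. mchar \<i> x) = 0"
    using sum_mchar[of \<i>] root_power_card(1)[OF i] by (simp add: complex_eq_iff)
  then have "of_int (\<Sum>x\<in>UNIV. char_re x) + of_int (\<Sum>x\<in>UNIV. char_im x) * \<i>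
      = of_int 0 + of_int 0 * \<i>"
    by (simp add: mchar_root_eq[OF i] sum.distrib sum_distrib_right)
  then show "(\<Sum>x\<in>UNIV. char_re x) = 0" "(\<Sum>x\<in>UNIV. char_im x) = 0"
    unfolding complex_of_int_eq_iff by auto
qed

text \<open>With \<open>J = J(\<chi>\<^sup>2, \<chi>)\<close>, the sum of \<open>(\<chi>(x) - 1)(\<chi>\<^sup>2(1 - x) - 1)\<close> over all \<open>x\<close> equals
  \<open>J + q\<close>, and each summand is divisible by \<open>2 + 2i\<close>.\<close>

lemma jacobi_quadratic_cong:
  obtains a b :: int where "jacobi (-1) \<i> = of_int a + of_int b * \<i>"
    "even b" "4 dvd a + int CARD('a) - b"
proof
  have i: "\<i>\<^sup>2 = -1"
    by simp
  define e :: "'a \<Rightarrow> int" where "e = mchar (-1)"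
  define a where "a = (\<Sum>x\<in>UNIV. char_re x * e (1 - x))"
  define b where "b = (\<Sum>x\<in>UNIV. char_im x * e (1 - x))"
  have "jacobi (-1) \<i> = conv (mchar \<i>) (mchar (-1)) 1"
    unfolding conv_commute[of "mchar \<i>"] by (simp add: jacobi_def conv_def)
  also have "\<dots> = (\<Sum>x\<in>UNIV. mchar \<i> x * of_int (e (1 - x)))"
    unfolding e_def conv_def mchar_minus_1_of_int[symmetric] ..
  also have "\<dots> = of_int a + of_int b * \<i>"
    by (simp add: mchar_root_eq[OF i] a_def b_def sum.distrib sum_distrib_left algebra_simps)
  finally show "jacobi (-1) \<i> = of_int a + of_int b * \<i>" .
  have m1: "(-1 :: int) ^ (CARD('a) - 1) = 1"
    using odd_card by simp
  have e1: "e 1 = 1" "e 0 = 0"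
    using m1 by (simp_all add: e_def)
  have e_odd: "even (e x - 1)" if "x \<noteq> 0" for x
    using that by (simp add: e_def mchar_def)
  have sum_e: "(\<Sum>x\<in>UNIV. e (1 - x)) = 0"
    using sum_UNIV_minus[of e 1] sum_mchar[OF m1] by (simp add: e_def)
  have one: "char_re 1 = 1" "char_im 1 = 0"
    using ind_gen_power[of 0] by (simp_all add: char_re_def char_im_def quarter_cos_def quarter_sin_def)
  have "b = (\<Sum>x\<in>UNIV. char_im x * (e (1 - x) - 1))"
    by (simp add: b_def right_diff_distrib sum_subtractf sum_char_im)
  moreover have "even (char_im x * (e (1 - x) - 1))" for x
    using e_odd[of "1 - x"] one by (cases "x = 1") auto
  ultimately show "even b"
    by (simp add: dvd_sum)
  \<comment> \<open>For \<open>x + yi\<close>, divisibility by \<open>2 + 2i\<close> means that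
    \<open>y\<close> is even and \<open>4\<close> divides \<open>x - y\<close>; hence the difference
    of real and imaginary parts.\<close>
  have "a + int CARD('a) - b = (\<Sum>x\<in>UNIV. (char_re x - char_im x - 1) * (e (1 - x) - 1))"
    by (simp add: a_def b_def algebra_simps sum_subtractf sum.distrib sum_char_re sum_char_im sum_e)
  \<comment> \<open>At \<open>0\<close> the second factor vanishes, at \<open>1\<close> the first.
    Elsewhere both are even, as exactly one of \<open>char_re x\<close>, \<open>char_im x\<close> is
    nonzero, and it is a unit.\<close>
  moreover have "4 dvd (char_re x - char_im x - 1) * (e (1 - x) - 1)" for x
  proof (cases "x = 0 \<or> x = 1")
    case True
    then show ?thesis
      using e1 one by (auto simp: char_re_def)
  next
    case False
    have "even (char_re x - char_im x - 1)"
      using False by (auto simp: char_re_def char_im_def quarter_cos_def quarter_sin_def)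
    then have "2 * 2 dvd (char_re x - char_im x - 1) * (e (1 - x) - 1)"
      using e_odd[of "1 - x"] False by (intro mult_dvd_mono) auto
    then show ?thesis
      by simp
  qed
  ultimately show "4 dvd a + int CARD('a) - b"
    by (simp add: dvd_sum)
qed

text \<open>Write \<open>q = 4k + 1\<close>. The congruence for
  \<open>J(\<chi>^2, \<chi>) = a + bi\<close> gives \<open>a\<close> modulo 4 in terms of
  \<open>b\<close>, and the norm shows that \<open>b / 2\<close> has the parity of \<open>k\<close>.
  The factor \<open>\<chi>(-1) = (-1)^k\<close> then compensates exactly.\<close>

lemma jacobi_re_im_cong: "[- jacobi_re = 1] (mod 4)" "even jacobi_im"
proof -
  have i: "\<i>\<^sup>2 = -1"
    by simp
  obtain a b :: int where ab: "jacobi (-1) \<i> = of_int a + of_int b * \<i>"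
    "even b" "4 dvd a + int CARD('a) - b"
    by (rule jacobi_quadratic_cong)
  let ?k = "(CARD('a) - 1) div 4"
  have q: "int CARD('a) = 4 * int ?k + 1"
    using four_dvd card_field_ge_2[where 'a = 'a] by auto
  have "of_int jacobi_re + of_int jacobi_im * \<i> =
      of_int ((-1) ^ ?k * a) + of_int ((-1) ^ ?k * b) * \<i>"
    using jacobi_diag[OF i] unfolding jacobi_root_eq[OF i] ab(1) mchar_minus_1_root(1)[OF i]
    by (simp add: algebra_simps)
  then have re: "jacobi_re = (-1) ^ ?k * a" and im: "jacobi_im = (-1) ^ ?k * b"
    unfolding complex_of_int_eq_iff by auto
  then show "even jacobi_im"
    using ab(2) by simp
  obtain b' where b': "b = 2 * b'"
    using ab(2) by blast
  obtain l where l: "a + int CARD('a) - b = 4 * l"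
    using ab(3) by blast
  have "jacobi_re\<^sup>2 = a\<^sup>2" "jacobi_im\<^sup>2 = b\<^sup>2"
    by (simp_all add: re im power_mult_distrib flip: power_mult)
  then have norm: "a\<^sup>2 + b\<^sup>2 = 4 * int ?k + 1"
    using jacobi_re_im_norm q by simp
  have a: "a = 2 * (2 * l - 2 * int ?k + b' - 1) + 1"
    using l q b' by simp
  \<comment> \<open>With \<open>a = 2d + 1\<close>, the norm equation becomes
    \<open>d(d + 1) + b'^2 = k\<close>, whose first term is even.\<close>
  define d where "d = 2 * l - 2 * int ?k + b' - 1"
  have "4 * (d * (d + 1)) + 4 * b'\<^sup>2 = 4 * int ?k"
    using norm unfolding a b' d_def[symmetric] by (simp add: power2_eq_square algebra_simps)
  then have "d * (d + 1) + b'\<^sup>2 = int ?k"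
    by linarith
  moreover have "even (d * (d + 1))"
    by simp
  ultimately have par: "even b' \<longleftrightarrow> even ?k"
    by (metis even_add even_of_nat even_power zero_less_numeral)
  show "[- jacobi_re = 1] (mod 4)"
  proof (cases "even ?k")
    case True
    then obtain c where "b' = 2 * c"
      using par by blast
    then have "- jacobi_re = 1 + 4 * (int ?k - l - c)"
      using True re a by simp
    then show ?thesis
      by (simp only: cong_def mod_mult_self2)
  next
    case False
    then obtain c where "b' = 2 * c + 1"
      using par by (auto elim: oddE)
    then have "- jacobi_re = 1 + 4 * (l + c - int ?k)"
      using False re a by simp
    then show ?thesis
      by (simp only: cong_def mod_mult_self2)
  qed
qed

end

section \<open>Identification of s and t\<close>

lemma fact_times_prime_add:
  fixes p a b :: nat
  assumes "prime p" "b < p"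
  shows "\<exists>u. fact (p * a + b) = p ^ a * fact a * u \<and> \<not> p dvd u"
  using assms(2)
proof (induction a arbitrary: b)
  case 0
  then show ?case
    using assms(1) by (intro exI[of _ "fact b"]) (simp add: prime_dvd_fact_iff)
next
  case (Suc a)
  then show ?case
  proof (induction b)
    case 0
    obtain u where u: "fact (p * a + (p - 1)) = p ^ a * fact a * u" "\<not> p dvd u"
      using "0.prems"(1)[of "p - 1"] assms(1) prime_gt_0_nat by auto
    \<comment> \<open>Stepping from \<open>p * a + (p - 1)\<close> to the next multiple of
      \<open>p\<close> contributes the factor \<open>p * Suc a\<close>; all other new factors are
      prime to \<open>p\<close>.\<close>
    have "p * Suc a + 0 = Suc (p * a + (p - 1))"
      using prime_gt_0_nat[OF assms(1)] by simp
    then have "fact (p * Suc a + 0) = (p * Suc a) * fact (p * a + (p - 1))"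
      by (metis Nat.add_0_right fact_Suc of_nat_id)
    also have "\<dots> = p ^ Suc a * fact (Suc a) * u"
      unfolding u(1) by (simp add: algebra_simps)
    finally show ?case
      using u(2) by blast
  next
    case (Suc b)
    then obtain u where u: "fact (p * Suc a + b) = p ^ Suc a * fact (Suc a) * u" "\<not> p dvd u"
      by auto
    have "fact (p * Suc a + Suc b) = (p * Suc a + Suc b) * fact (p * Suc a + b)"
      using fact_Suc[of "p * Suc a + b", where 'a = nat] by simp
    also have "\<dots> = p ^ Suc a * fact (Suc a) * ((p * Suc a + Suc b) * u)"
      unfolding u(1) by (simp only: ac_simps)
    finally have "fact (p * Suc a + Suc b) = p ^ Suc a * fact (Suc a) * ((p * Suc a + Suc b) * u)" .
    moreover have "\<not> p dvd p * Suc a + Suc b"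
      using Suc.prems(2) dvd_add_right_iff[of p "p * Suc a" "Suc b"] by (simp add: nat_dvd_not_less)
    then have "\<not> p dvd (p * Suc a + Suc b) * u"
      using u(2) assms(1) prime_dvd_mult_nat by blast
    ultimately show ?case
      by blast
  qed
qed

text \<open>One step of Lucas' theorem: as \<open>e \<le> d\<close>, subtraction needs no borrow, so
  the powers of \<open>p\<close> in the three factorials cancel, and what remains compares the two
  binomial coefficients up to the factor \<open>u\<close> prime to \<open>p\<close>.\<close>

lemma not_dvd_binomial_digit:
  fixes p n k d e :: nat
  assumes p: "prime p" and "d < p" "e \<le> d" "k \<le> n" "\<not> p dvd (n choose k)"
  shows "\<not> p dvd (p * n + d choose (p * k + e))"
proof -
  obtain u where u: "fact (p * n + d) = p ^ n * fact n * u" "\<not> p dvd u"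
    using fact_times_prime_add[OF p assms(2)] by blast
  obtain v where v: "fact (p * k + e) = p ^ k * fact k * v"
    using fact_times_prime_add[OF p, of e] assms(2,3) by fastforce
  obtain w where w: "fact (p * (n - k) + (d - e)) = p ^ (n - k) * fact (n - k) * w"
    using fact_times_prime_add[OF p, of "d - e"] assms(2,3) by fastforce
  have le: "p * k + e \<le> p * n + d"
    using assms(3,4) by (simp add: add_mono)
  have sub: "p * n + d - (p * k + e) = p * (n - k) + (d - e)"
    using assms(3,4) by (simp add: diff_mult_distrib2)
  have pp: "p ^ n = p ^ k * p ^ (n - k)"
    using assms(4) by (simp flip: power_add)
  have "fact (p * k + e) * fact (p * (n - k) + (d - e)) * (p * n + d choose (p * k + e))
      = (fact (p * n + d) :: nat)"
    using binomial_fact_lemma[OF le] unfolding sub .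
  then have "p ^ n * fact k * fact (n - k) * ((p * n + d choose (p * k + e)) * v * w)
      = p ^ n * (fact n * u)"
    unfolding u v w pp by (simp only: ac_simps)
  also have "\<dots> = p ^ n * fact k * fact (n - k) * ((n choose k) * u)"
    using binomial_fact_lemma[OF assms(4)] by (metis mult.assoc)
  finally have "(p * n + d choose (p * k + e)) * v * w = (n choose k) * u"
    using prime_gt_0_nat[OF p] by simp
  then show ?thesis
    using u(2) assms(5) p by (metis dvd_mult2 prime_dvd_mult_iff)
qed

text \<open>With \<open>p = 4r + 1\<close>, all base \<open>p\<close> digits of
  \<open>(p^m - 1)/4\<close> are \<open>r\<close> and those of its triple are \<open>3r < p\<close>;
  induction on the number of digits.\<close>

lemma not_dvd_binomial_quarter:
  fixes p m :: nat
  assumes "prime p" "[p = 1] (mod 4)"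
  shows "\<not> p dvd (3 * ((p ^ m - 1) div 4) choose ((p ^ m - 1) div 4))"
proof -
  have "p = 4 * (p div 4) + 1"
    using assms(2) mult_div_mod_eq[of 4 p] by (simp add: cong_def)
  then obtain r where r: "p = 4 * r + 1" ..
  have q: "\<exists>k. p ^ m = 4 * k + 1 \<and> \<not> p dvd (3 * k choose k)"
  proof (induction m)
    case 0
    show ?case
      using assms(1) by (intro exI[of _ 0]) (auto dest: prime_gt_1_nat)
  next
    case (Suc m)
    then obtain k where k: "p ^ m = 4 * k + 1" "\<not> p dvd (3 * k choose k)"
      by blast
    have "p ^ Suc m = 4 * (p * k + r) + 1"
      by (simp add: k(1) algebra_simps) (simp add: r)
    moreover have "\<not> p dvd (p * (3 * k) + 3 * r choose (p * k + r))"
      by (rule not_dvd_binomial_digit) (use assms k r in auto)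
    ultimately show ?case
      by (intro exI[of _ "p * k + r"]) (simp add: algebra_simps)
  qed
  then show ?thesis
    by auto
qed

section \<open>Representations of prime powers as sums of two squares\<close>

lemma prime_3_mod_4_dvd_sum_squares:
  fixes p a b :: nat
  assumes "prime p" "[p = 3] (mod 4)" "p dvd a\<^sup>2 + b\<^sup>2"
  shows "p dvd a"
proof (rule ccontr)
  assume a: "\<not> p dvd a"
  have b: "\<not> p dvd b"
  proof
    assume "p dvd b"
    then have "p dvd b\<^sup>2"
      by (simp add: power2_eq_square)
    then have "p dvd a\<^sup>2"
      using assms(3) by (simp add: dvd_add_left_iff)
    then show False
      using a assms(1) prime_dvd_power by blast
  qed
  define h where "h = (p - 1) div 2"
  have h: "p - 1 = 2 * h" "odd h"
    using assms(2) unfolding h_def cong_def by presburger+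
  have "[(int a)\<^sup>2 = - ((int b)\<^sup>2)] (mod int p)"
    using assms(3) by (simp add: cong_iff_dvd_diff) (metis of_nat_add of_nat_dvd_iff of_nat_power)
  \<comment> \<open>Raising to the odd power \<open>(p - 1)/2\<close> keeps the sign, while Fermat's
    theorem turns both sides into \<open>1\<close> and \<open>-1\<close>.\<close>
  then have "[((int a)\<^sup>2) ^ h = (- ((int b)\<^sup>2)) ^ h] (mod int p)"
    by (rule cong_pow)
  then have "[int (a ^ (p - 1)) = - int (b ^ (p - 1))] (mod int p)"
    using h by (simp add: power_minus_odd flip: power_mult)
  moreover have "[int (a ^ (p - 1)) = 1] (mod int p)" "[int (b ^ (p - 1)) = 1] (mod int p)"
    using fermat_theorem[OF assms(1) a] fermat_theorem[OF assms(1) b]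
    by (metis cong_int_iff of_nat_1)+
  ultimately have "[1 = - 1] (mod int p)"
    by (metis cong_minus_minus_iff cong_trans cong_sym)
  then have "int p dvd 2"
    by (simp add: cong_iff_dvd_diff)
  then have "p \<le> 2"
    by (metis int_dvd_int_iff of_nat_numeral dvd_imp_le zero_less_numeral)
  then show False
    using assms(1,2) prime_ge_2_nat[of p] by (auto simp: cong_def)
qed

text \<open>Descent: \<open>p\<close> divides both entries, so \<open>p^2\<close> can be cancelled
  until the sum of squares is \<open>1\<close>.\<close>

lemma sum_squares_prime_3_mod_4_power:
  fixes p k :: nat and a b :: int
  assumes "prime p" "[p = 3] (mod 4)" "a\<^sup>2 + b\<^sup>2 = int p ^ (2 * k)"
  shows "a = 0 \<or> b = 0"
  using assms(3)
proof (induction k arbitrary: a b)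
  case 0
  show ?case
  proof (rule ccontr)
    assume "\<not> (a = 0 \<or> b = 0)"
    then have "a\<^sup>2 \<ge> 1" "b\<^sup>2 \<ge> 1"
      by (auto simp: int_one_le_iff_zero_less)
    then show False
      using 0 by simp
  qed
next
  case (Suc k)
  have *: "int p dvd c" if "c\<^sup>2 + d\<^sup>2 = int p ^ (2 * Suc k)" for c d
  proof -
    have "int ((nat \<bar>c\<bar>)\<^sup>2 + (nat \<bar>d\<bar>)\<^sup>2) = int p ^ (2 * Suc k)"
      using that by simp
    then have "int p dvd int ((nat \<bar>c\<bar>)\<^sup>2 + (nat \<bar>d\<bar>)\<^sup>2)"
      by (simp only:) (simp add: dvd_power)
    then have "p dvd (nat \<bar>c\<bar>)\<^sup>2 + (nat \<bar>d\<bar>)\<^sup>2"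
      by (simp only: int_dvd_int_iff)
    then have "p dvd nat \<bar>c\<bar>"
      by (rule prime_3_mod_4_dvd_sum_squares[OF assms(1,2)])
    then show ?thesis
      by (metis dvd_abs_iff int_dvd_int_iff int_nat_eq abs_ge_zero)
  qed
  obtain a' b' where ab: "a = int p * a'" "b = int p * b'"
    using *[of a b] *[of b a] Suc.prems by (auto simp: add.commute elim!: dvdE)
  have p0: "p \<noteq> 0"
    using assms(1) by auto
  have "(int p)\<^sup>2 * (a'\<^sup>2 + b'\<^sup>2) = (int p)\<^sup>2 * int p ^ (2 * k)"
    using Suc.prems unfolding ab by (simp add: power_mult_distrib algebra_simps power2_eq_square)
  then have "a'\<^sup>2 + b'\<^sup>2 = int p ^ (2 * k)"
    using p0 by simp
  then show ?case
    using Suc.IH ab by fastforce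
qed

text \<open>Composition of Gaussian integers: the hypothesis \<open>ndvd\<close> forces
  \<open>q\<close> to divide \<open>X\<close>, the norm \<open>X^2 + Y^2 = q^2\<close> then leaves
  only \<open>Y = 0\<close>, and the congruences exclude the sign change.\<close>

lemma sum_squares_unique:
  fixes p m :: nat and s t s' t' :: int
  assumes p: "prime p" "odd p"
    and st: "s\<^sup>2 + 4 * t\<^sup>2 = int (p ^ m)" "s'\<^sup>2 + 4 * t'\<^sup>2 = int (p ^ m)"
    and cong: "[s = 1] (mod 4)" "[s' = 1] (mod 4)"
    and ndvd: "\<not> int p dvd s * s' - 4 * t * t'"
  shows "s = s' \<and> t = t'"
proof -
  define q where "q = int (p ^ m)"
  have q0: "q > 0"
    using p(1) by (simp add: q_def prime_gt_0_nat)
  \<comment> \<open>\<open>X\<close> and \<open>Y\<close> are the real and imaginary parts of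
    \<open>(s - 2ti)(s' + 2t'i)\<close>.\<close>
  define X where "X = s * s' + 4 * t * t'"
  define Y where "Y = 2 * (s * t' - t * s')"
  have t: "4 * t\<^sup>2 = q - s\<^sup>2" "4 * t'\<^sup>2 = q - s'\<^sup>2"
    using st by (simp_all add: q_def)
  have "X * (s * s' - 4 * t * t') = s\<^sup>2 * s'\<^sup>2 - (4 * t\<^sup>2) * (4 * t'\<^sup>2)"
    by (simp add: X_def power2_eq_square algebra_simps)
  also have "\<dots> = q * (s\<^sup>2 + s'\<^sup>2 - q)"
    unfolding t by (simp add: power2_eq_square algebra_simps)
  finally have "q dvd X * (s * s' - 4 * t * t')"
    by simp
  moreover have "coprime q (s * s' - 4 * t * t')"
    using ndvd p(1) by (auto simp: q_def intro!: prime_imp_coprime coprime_power_left_iff[THEN iffD2])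
  ultimately have "q dvd X"
    by (simp add: coprime_dvd_mult_left_iff)
  then obtain l where l: "X = q * l"
    by blast
  have XY: "X\<^sup>2 + Y\<^sup>2 = q\<^sup>2"
  proof -
    have "X\<^sup>2 + Y\<^sup>2 = (s\<^sup>2 + 4 * t\<^sup>2) * (s'\<^sup>2 + 4 * t'\<^sup>2)"
      by (simp add: X_def Y_def power2_eq_square algebra_simps)
    then show ?thesis
      using st by (simp add: q_def power2_eq_square)
  qed
  \<comment> \<open>\<open>Y\<close> is even and \<open>q\<close> odd, so \<open>X = 0\<close> is
    impossible.\<close>
  have "odd q"
    using p by (simp add: q_def)
  then have "Y\<^sup>2 \<noteq> q\<^sup>2"
    using even_power[of Y 2] even_power[of q 2] by (metis Y_def dvd_triv_left zero_less_numeral)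
  then have "l \<noteq> 0"
    using XY l by auto
  then have "l\<^sup>2 \<ge> 1"
    by (simp add: int_one_le_iff_zero_less)
  then have "q\<^sup>2 * 1 \<le> q\<^sup>2 * l\<^sup>2"
    using q0 by (intro mult_left_mono) auto
  then have "Y\<^sup>2 \<le> 0"
    using XY unfolding l power_mult_distrib by linarith
  then have Y: "s * t' = t * s'"
    by (simp add: Y_def)
  then have "Y = 0"
    by (simp add: Y_def)
  then have "l\<^sup>2 = 1"
    using XY l q0 by (simp add: power_mult_distrib)
  have "s * X = s\<^sup>2 * s' + 4 * t * (s * t')"
    by (simp add: X_def power2_eq_square algebra_simps)
  also have "\<dots> = s' * (s\<^sup>2 + 4 * t\<^sup>2)"
    unfolding Y by (simp add: power2_eq_square algebra_simps)
  finally have "q * (s * l) = q * s'"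
    using st(1) l by (simp add: q_def ac_simps)
  then have "s' = s * l"
    using q0 by simp
  then have "s' = s \<or> s' = - s"
    using \<open>l\<^sup>2 = 1\<close> by (auto simp: power2_eq_1_iff)
  moreover have "s' \<noteq> - s"
    using cong unfolding cong_def by presburger
  moreover have "s \<noteq> 0"
    using cong(1) by (auto simp: cong_def)
  ultimately show ?thesis
    using Y by (auto simp: mult.commute)
qed

section \<open>The Jacobi sum read in the finite field\<close>

context generator
begin

lemma of_int_eq_0_iff_dvd:
  assumes "prime p" "CARD('a) = p ^ m"
  shows "(of_int n :: 'a) = 0 \<longleftrightarrow> int p dvd n"
proof -
  have "(of_nat p :: 'a) ^ m = 0"
    using of_nat_card_eq_0[where 'a = 'a] assms(2) by simp
  then have "(of_nat p :: 'a) = 0"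
    by (rule power_eq_0_iff[THEN iffD1, THEN conjunct1])
  then have "CHAR('a) dvd p"
    by (simp add: of_nat_eq_0_iff_char_dvd)
  then have "CHAR('a) = p"
    using assms(1) CHAR_not_1[where 'a = 'a] by (auto simp: prime_nat_iff One_nat_def)
  then show ?thesis
    by (simp add: of_int_eq_0_iff_char_dvd)
qed

text \<open>In the field the Jacobi sum is the sum of \<open>x^n (1 - x)^n\<close>, which the
  binomial theorem splits into power sums.\<close>

lemma jacobi_gen_power:
  assumes "0 < n"
  shows "jacobi (g ^ n) (g ^ n) = (\<Sum>j\<le>n. of_nat (n choose j) * (-1) ^ j * (\<Sum>x\<in>UNIV. x ^ (n + j)))"
proof -
  have "jacobi (g ^ n) (g ^ n) = (\<Sum>x\<in>UNIV. x ^ n * (- x + 1) ^ n)"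
    by (simp add: jacobi_def mchar_gen_power_base[OF assms])
  also have "\<dots> = (\<Sum>x\<in>UNIV. \<Sum>j\<le>n. of_nat (n choose j) * (-1) ^ j * x ^ (n + j))"
  proof (rule sum.cong[OF refl])
    fix x :: 'a
    have "x ^ n * (of_nat (n choose j) * (- x) ^ j * 1 ^ (n - j)) =
        of_nat (n choose j) * (-1) ^ j * x ^ (n + j)" for j
      unfolding power_minus[of x] by (simp add: power_add ac_simps)
    then show "x ^ n * (- x + 1) ^ n = (\<Sum>j\<le>n. of_nat (n choose j) * (-1) ^ j * x ^ (n + j))"
      unfolding binomial_ring sum_distrib_left by (intro sum.cong refl)
  qed
  also have "\<dots> = (\<Sum>j\<le>n. \<Sum>x\<in>UNIV. of_nat (n choose j) * (-1) ^ j * x ^ (n + j))"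
    by (rule sum.swap)
  finally show ?thesis
    by (simp add: sum_distrib_left)
qed

end

context generator_1_mod_4
begin

lemma card_eq: "CARD('a) - 1 = 4 * ((CARD('a) - 1) div 4)" "0 < (CARD('a) - 1) div 4"
  using four_dvd card_field_ge_2[where 'a = 'a] by auto

text \<open>With \<open>q - 1 = 4k\<close>, all exponents lie between \<open>k\<close> and
  \<open>2k\<close>, so every power sum vanishes.\<close>

lemma jacobi_gen_quarter:
  "jacobi (g ^ ((CARD('a) - 1) div 4)) (g ^ ((CARD('a) - 1) div 4)) = 0"
proof -
  let ?k = "(CARD('a) - 1) div 4"
  have "(\<Sum>x\<in>UNIV. x ^ (?k + j) :: 'a) = 0" if "j \<le> ?k" for j
  proof -
    have "\<not> CARD('a) - 1 dvd ?k + j"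
      using that card_eq by (intro nat_dvd_not_less) linarith+
    then show ?thesis
      using card_eq(2) by (simp add: sum_power)
  qed
  then show ?thesis
    unfolding jacobi_gen_power[OF card_eq(2)] by (intro sum.neutral) simp
qed

text \<open>The exponents run from \<open>3k\<close> to \<open>6k\<close>; the only multiple of
  \<open>q - 1 = 4k\<close> among them is \<open>4k\<close>, at \<open>j = k\<close>.\<close>

lemma jacobi_gen_three_quarters:
  defines "k \<equiv> (CARD('a) - 1) div 4"
  shows "jacobi (g ^ (3 * k)) (g ^ (3 * k)) = - ((-1) ^ k * of_nat (3 * k choose k))"
proof -
  have k: "CARD('a) - 1 = 4 * k" "0 < k"
    using card_eq by (simp_all add: k_def)
  have s: "(\<Sum>x\<in>UNIV. x ^ (3 * k + j) :: 'a) = (if j = k then -1 else 0)" if "j \<le> 3 * k" for j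
  proof -
    have "4 * k dvd 3 * k + j \<longleftrightarrow> j = k"
    proof
      assume "4 * k dvd 3 * k + j"
      then obtain c where c: "3 * k + j = 4 * k * c"
        by blast
      have "c \<noteq> 0"
        using c k(2) by (intro notI) simp
      moreover have "\<not> 2 \<le> c"
        using mult_le_mono2[of 2 c "4 * k"] c k(2) that by linarith
      ultimately have "c = 1"
        by linarith
      then show "j = k"
        using c by simp
    qed auto
    then show ?thesis
      using k by (simp add: sum_power)
  qed
  have "jacobi (g ^ (3 * k)) (g ^ (3 * k)) =
      (\<Sum>j\<le>3 * k. if j = k then - (of_nat (3 * k choose j) * (-1) ^ j) else 0)"
    using k(2) by (subst jacobi_gen_power, simp) (intro sum.cong refl, simp add: s)
  then show ?thesis
    by (simp add: mult.commute)
qed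

text \<open>Existence of \<open>s\<close> and \<open>t\<close>, read off from the Jacobi sum written
  as \<open>-s + 2ti\<close>.\<close>

lemma is_st_jacobi:
  assumes p: "prime p" "odd p" and card: "CARD('a) = p ^ m"
  shows "is_st p m g (- jacobi_re) (jacobi_im div 2)"
proof -
  define s where "s = - jacobi_re"
  define t where "t = jacobi_im div 2"
  define k where "k = (CARD('a) - 1) div 4"
  let ?w = "g ^ k"
  have re: "jacobi_re = - s" and im: "jacobi_im = 2 * t"
    using jacobi_re_im_cong(2) by (simp_all add: s_def t_def)
  have norm: "int (p ^ m) = s\<^sup>2 + 4 * t\<^sup>2"
    using jacobi_re_im_norm unfolding re im card by (simp add: power_mult_distrib)
  have s1: "[s = 1] (mod 4)"
    using jacobi_re_im_cong(1) by (simp add: s_def)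
  have w: "?w\<^sup>2 = -1" "(- ?w)\<^sup>2 = -1"
    using gen_root by (simp_all add: k_def)
  have w3: "g ^ (3 * k) = - ?w"
    using w(1) by (simp add: mult.commute[of 3] power_mult power3_eq_cube power2_eq_square)
  have k4: "3 * (p ^ m - 1) div 4 = 3 * k"
    using card_eq(1) unfolding card k_def by presburger
  have "is_st p m g s t"
  proof (cases "[p = 1] (mod 4)")
    case True
    \<comment> \<open>The Jacobi sum vanishes in the field, which yields
      \<open>2t = s g^(3k)\<close>. Its conjugate does not vanish, so neither does \<open>s\<close>,
      for otherwise \<open>J1\<close> would give \<open>2t = 0\<close> too.\<close>
    have J1: "- of_int s + 2 * of_int t * ?w = 0"
      using jacobi_gen_quarter unfolding k_def[symmetric] jacobi_root_eq[OF w(1)] re im by simp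
    have "jacobi (- ?w) (- ?w) \<noteq> 0"
      using jacobi_gen_three_quarters not_dvd_binomial_quarter[OF p(1) True, of m]
        of_int_eq_0_iff_dvd[OF p(1) card, of "int (3 * k choose k)"]
      by (simp add: w3 k_def[symmetric] card[symmetric])
    then have "- of_int s - 2 * of_int t * ?w \<noteq> 0"
      unfolding jacobi_root_eq[OF w(2)] re im by simp
    then have "(of_int s :: 'a) \<noteq> 0"
      using J1 by auto
    then have "\<not> int p dvd s"
      by (simp add: of_int_eq_0_iff_dvd[OF p(1) card])
    then have "coprime (int p) s"
      using p(1) by (intro prime_imp_coprime) auto
    moreover have "of_int (2 * t) = of_int s * (- ?w)"
    proof -
      have "of_int s = 2 * of_int t * ?w"
        using J1 by (simp add: algebra_simps)
      then have "of_int s * (- ?w) = - (2 * of_int t * ?w\<^sup>2)"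
        by (simp add: power2_eq_square)
      then show ?thesis
        by (simp add: w(1))
    qed
    ultimately show ?thesis
      using True norm s1 by (simp add: is_st_def k4 w3 coprime_iff_gcd_eq_1)
  next
    case False
    moreover have "p mod 4 = 1 \<or> p mod 4 = 3"
      using p(2) by presburger
    ultimately have p3: "[p = 3] (mod 4)"
      by (simp add: cong_def)
    have "even m"
    proof (rule ccontr)
      assume "odd m"
      then obtain n where n: "m = 2 * n + 1"
        using oddE by blast
      have "[p ^ m = 3 ^ m] (mod 4)"
        using p3 by (rule cong_pow)
      also have "3 ^ m = (3 ^ 2) ^ n * (3 :: nat)"
        unfolding n power_add power_mult by simp
      also have "[(3 ^ 2) ^ n * 3 = 1 ^ n * (3 :: nat)] (mod 4)"
        by (intro cong_mult cong_pow) (auto simp: cong_def)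
      finally have "[p ^ m = 3] (mod 4)"
        by simp
      then show False
        using card_cong by (simp add: card cong_def)
    qed
    then obtain n where n: "m = 2 * n"
      by blast
    have "s\<^sup>2 + (2 * t)\<^sup>2 = int p ^ (2 * n)"
      using norm n by (simp add: power_mult_distrib)
    then have "s = 0 \<or> 2 * t = 0"
      by (rule sum_squares_prime_3_mod_4_power[OF p(1) p3])
    moreover have "s \<noteq> 0"
      using s1 by (auto simp: cong_def)
    ultimately have t: "t = 0"
      by simp
    have "s\<^sup>2 = ((- int p) ^ n)\<^sup>2"
      using norm n t by (simp flip: power_mult) (simp add: mult.commute)
    then have "s = (- int p) ^ n \<or> s = - ((- int p) ^ n)"
      by (simp add: power2_eq_iff)
    \<comment> \<open>The norm leaves two signs; \<open>-p\<close> is \<open>1\<close> modulo 4, and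
      so is \<open>s\<close>.\<close>
    moreover have "[(- int p) ^ n = 1 ^ n] (mod 4)"
    proof (rule cong_pow)
      have "p = 4 * (p div 4) + 3"
        using p3 mult_div_mod_eq[of 4 p] by (simp add: cong_def)
      then obtain r where "p = 4 * r + 3" ..
      then have "- int p = 1 + 4 * (- int r - 1)"
        by simp
      then show "[- int p = 1] (mod 4)"
        by (simp only: cong_def mod_mult_self2)
    qed
    then have "s \<noteq> - ((- int p) ^ n)"
      using s1 unfolding cong_def power_one by presburger
    ultimately show ?thesis
      using False t n by (simp add: is_st_def)
  qed
  then show ?thesis
    by (simp add: s_def t_def)
qed

text \<open>For both pairs \<open>2t = s ?w\<close> in the field, with \<open>?w^2 = -1\<close>.
  Hence \<open>ss' - 4tt'\<close> becomes \<open>2ss'\<close>, which is nonzero there, as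
  \<open>sum_squares_unique\<close> requires.\<close>

lemma is_st_unique:
  assumes p: "prime p" "odd p" and card: "CARD('a) = p ^ m"
    and st: "is_st p m g s t" "is_st p m g s' t'"
  shows "s = s' \<and> t = t'"
proof (cases "[p = 1] (mod 4)")
  case True
  let ?w = "g ^ (3 * (p ^ m - 1) div 4)"
  have "3 * (p ^ m - 1) div 4 * 2 = (CARD('a) - 1) div 4 * 2 * 3"
    using card_eq(1) unfolding card by presburger
  then have "?w\<^sup>2 = ((g ^ ((CARD('a) - 1) div 4))\<^sup>2) ^ 3"
    by (simp flip: power_mult)
  then have w: "?w\<^sup>2 = -1"
    using gen_root by simp
  have *: "s\<^sup>2 + 4 * t\<^sup>2 = int (p ^ m)" "s'\<^sup>2 + 4 * t'\<^sup>2 = int (p ^ m)"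
      "[s = 1] (mod 4)" "[s' = 1] (mod 4)" "gcd (int p) s = 1" "gcd (int p) s' = 1"
      "of_int (2 * t) = of_int s * ?w" "of_int (2 * t') = of_int s' * ?w"
    using st True by (auto simp: is_st_def)
  have "(of_int (s * s' - 4 * t * t') :: 'a) = of_int s * of_int s' - of_int (2 * t) * of_int (2 * t')"
    by simp
  also have "\<dots> = of_int s * of_int s' - of_int s * of_int s' * ?w\<^sup>2"
    unfolding *(7,8) by (simp add: power2_eq_square)
  also have "\<dots> = 2 * of_int s * of_int s'"
    by (simp add: w)
  finally have eq: "(of_int (s * s' - 4 * t * t') :: 'a) = 2 * of_int s * of_int s'" .
  have "(of_int s :: 'a) \<noteq> 0" "(of_int s' :: 'a) \<noteq> 0"
    unfolding of_int_eq_0_iff_dvd[OF p(1) card]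
    using *(5,6) p(1) not_prime_unit[of p] by (auto simp: gcd_proj1_iff)
  then have "\<not> int p dvd s * s' - 4 * t * t'"
    using two_neq_0[OF odd_card] unfolding of_int_eq_0_iff_dvd[OF p(1) card, symmetric] eq by simp
  then show ?thesis
    by (rule sum_squares_unique[OF p *(1-4)])
next
  case False
  then show ?thesis
    using st by (simp add: is_st_def)
qed

end

section \<open>Convolution powers\<close>

lemma num_sols_0: "num_sols 0 c = of_bool (c = 0)"
  by (auto simp: num_sols_def)

text \<open>The last coordinate is split off. Updating at \<open>Suc n\<close> is injective because
  the shorter tuples are extensional.\<close>

lemma num_sols_Suc:
  fixes c :: "'a::{field,finite}"
  shows "num_sols (Suc n) c = (\<Sum>x\<in>UNIV. num_sols n (c - x ^ 4))"
proof -
  define S where "S n c = {x \<in> {1..n} \<rightarrow>\<^sub>E (UNIV :: 'a set). (\<Sum>i=1..n. x i ^ 4) = c}" for n :: nat and c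
  let ?F = "\<lambda>(y, x). x(Suc n := y)"
  have ins: "{1..Suc n} = insert (Suc n) {1..n}"
    by auto
  have upd: "(\<Sum>i=1..n. (x(Suc n := y)) i ^ 4) = (\<Sum>i=1..n. x i ^ 4)" for x :: "nat \<Rightarrow> 'a" and y
    by (intro sum.cong) auto
  have "S (Suc n) c = ?F ` (SIGMA y:UNIV. S n (c - y ^ 4))"
  proof (intro equalityI subsetI)
    fix f assume "f \<in> S (Suc n) c"
    then have f: "f \<in> {1..Suc n} \<rightarrow>\<^sub>E UNIV" "(\<Sum>i=1..Suc n. f i ^ 4) = c"
      by (auto simp: S_def)
    then obtain y x where yx: "f = x(Suc n := y)" "x \<in> {1..n} \<rightarrow>\<^sub>E UNIV"
      unfolding ins PiE_insert_eq by auto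
    then have "x \<in> S n (c - y ^ 4)"
      using f(2) by (auto simp: S_def upd)
    then show "f \<in> ?F ` (SIGMA y:UNIV. S n (c - y ^ 4))"
      using yx(1) by (intro image_eqI[of _ _ "(y, x)"]) auto
  next
    fix f assume "f \<in> ?F ` (SIGMA y:UNIV. S n (c - y ^ 4))"
    then obtain y x where yx: "f = x(Suc n := y)" "x \<in> S n (c - y ^ 4)"
      by auto
    then have "f \<in> {1..Suc n} \<rightarrow>\<^sub>E UNIV"
      unfolding ins PiE_insert_eq by (auto simp: S_def)
    then show "f \<in> S (Suc n) c"
      using yx by (auto simp: S_def upd)
  qed
  moreover have "inj_on ?F (SIGMA y:UNIV. S n (c - y ^ 4))"
    by (rule inj_on_subset[OF inj_combinator[of "Suc n" "{1..n}" "\<lambda>_. UNIV"]]) (auto simp: S_def)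
  moreover have "finite (S n d)" for d
    by (simp add: S_def finite_PiE)
  ultimately have "card (S (Suc n) c) = (\<Sum>y\<in>UNIV. card (S n (c - y ^ 4)))"
    by (simp add: card_image)
  then show ?thesis
    by (simp add: num_sols_def S_def)
qed

lemma sum_num_sols: "(\<Sum>c\<in>UNIV. num_sols n (c :: 'a::{field,finite})) = CARD('a) ^ n"
proof (induction n)
  case 0
  show ?case
    by (simp add: num_sols_0)
next
  case (Suc n)
  have "(\<Sum>c\<in>UNIV. num_sols (Suc n) (c :: 'a)) = (\<Sum>x\<in>UNIV. \<Sum>c\<in>UNIV. num_sols n (c - x ^ 4 :: 'a))"
    unfolding num_sols_Suc by (rule sum.swap)
  also have "\<dots> = (\<Sum>x\<in>(UNIV :: 'a set). \<Sum>c\<in>UNIV. num_sols n (c :: 'a))"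
  proof (rule sum.cong[OF refl])
    fix x :: 'a
    show "(\<Sum>c\<in>UNIV. num_sols n (c - x ^ 4)) = (\<Sum>c\<in>UNIV. num_sols n (c :: 'a))"
      by (rule sum.reindex_bij_witness[of _ "\<lambda>c. c + x ^ 4" "\<lambda>c. c - x ^ 4"]) auto
  qed
  finally show ?case
    by (simp add: Suc.IH)
qed

definition conv_pow :: "('a::{field,finite} \<Rightarrow> 'b::comm_ring_1) \<Rightarrow> nat \<Rightarrow> 'a \<Rightarrow> 'b" where
  "conv_pow f n = (conv f ^^ n) (\<lambda>c. of_bool (c = 0))"

lemma conv_pow_Suc: "conv_pow f (Suc n) = conv f (conv_pow f n)"
  by (simp add: conv_pow_def)

lemma sum_eq_0_of_sum_comp_fourth:
  fixes f :: "'a::{field,finite} \<Rightarrow> 'b::comm_ring_1"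
  assumes "\<And>h. (\<Sum>x\<in>UNIV. h (x ^ 4)) = (\<Sum>w\<in>UNIV. h w) + (\<Sum>w\<in>UNIV. f w * h w)"
  shows "(\<Sum>x\<in>UNIV. f x) = 0"
  using assms[of "\<lambda>_. 1"] by simp

text \<open>The hypothesis says, tested against arbitrary \<open>h\<close>, that
  \<open>1 + f w\<close> counts the fourth roots of \<open>w\<close>. Convolving the counts with
  \<open>1\<close> gives their total, a power of \<open>q\<close>; convolving with \<open>f\<close>
  kills the constant part.\<close>

lemma num_sols_eq_conv_pow:
  fixes f :: "'a::{field,finite} \<Rightarrow> 'b::comm_ring_1"
  assumes f: "\<And>h. (\<Sum>x\<in>UNIV. h (x ^ 4)) = (\<Sum>w\<in>UNIV. h w) + (\<Sum>w\<in>UNIV. f w * h w)"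
  shows "of_nat (num_sols (Suc n) c) = of_nat CARD('a) ^ n + conv_pow f (Suc n) c"
proof (induction n arbitrary: c)
  case 0
  have "of_nat (num_sols (Suc 0) c) = (\<Sum>x\<in>UNIV. of_bool (c - x ^ 4 = 0))"
    by (simp add: num_sols_Suc num_sols_0 of_nat_sum)
  also have "\<dots> = (\<Sum>x\<in>UNIV. of_bool (c - x = 0)) + conv_pow f (Suc 0) c"
    using f[of "\<lambda>w. of_bool (c - w = 0)"] by (simp add: conv_pow_def conv_def)
  also have "(\<Sum>x\<in>UNIV. of_bool (c - x = 0) :: 'b) = 1"
    using sum_UNIV_minus[of "\<lambda>x. of_bool (x = 0) :: 'b" c] by simp
  finally show ?case
    by simp
next
  case (Suc n)
  let ?N = "\<lambda>c. of_nat (num_sols (Suc n) c) :: 'b"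
  have "of_nat (num_sols (Suc (Suc n)) c) = (\<Sum>x\<in>UNIV. ?N (c - x ^ 4))"
    by (simp only: num_sols_Suc[of "Suc n"] of_nat_sum)
  also have "\<dots> = (\<Sum>w\<in>UNIV. ?N (c - w)) + conv f ?N c"
    using f[of "\<lambda>w. ?N (c - w)"] by (simp only: conv_def)
  also have "(\<Sum>w\<in>UNIV. ?N (c - w)) = of_nat CARD('a) ^ Suc n"
    unfolding sum_UNIV_minus[of ?N] using sum_num_sols[of "Suc n", where 'a = 'a]
    by (simp only: flip: of_nat_sum of_nat_power)
  also have "conv f ?N c = conv_pow f (Suc (Suc n)) c"
    unfolding Suc.IH conv_add_right conv_const_right sum_eq_0_of_sum_comp_fourth[OF f] conv_pow_Suc[of f "Suc n"]
    by simp
  finally show ?case .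
qed

text \<open>One further convolution with \<open>f\<close> removes the constant \<open>e\<close>, so
  the recurrence is homogeneous from the fifth power on.\<close>

lemma conv_pow_recurrence:
  assumes "(\<Sum>x\<in>UNIV. f x) = 0"
    and "\<And>c. conv_pow f 4 c = a * conv_pow f 2 c + b * conv_pow f 1 c + d * conv_pow f 0 c + e"
  shows "conv_pow f (n + 5) c = a * conv_pow f (n + 3) c + b * conv_pow f (n + 2) c + d * conv_pow f (n + 1) c"
proof (induction n arbitrary: c)
  case 0
  have "conv_pow f 5 c = conv f (conv_pow f 4) c"
    using conv_pow_Suc[of f 4] by simp
  also have "\<dots> = conv f (\<lambda>c. a * conv_pow f 2 c + b * conv_pow f 1 c + d * conv_pow f 0 c + e) c"
    using assms(2) by presburger
  also have "\<dots> = a * conv_pow f (Suc 2) c + b * conv_pow f (Suc 1) c + d * conv_pow f (Suc 0) c"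
    unfolding conv_add_right conv_scale_right conv_const_right assms(1) conv_pow_Suc by simp
  finally show ?case
    by (simp add: numeral_eq_Suc One_nat_def)
next
  case (Suc n)
  have "conv_pow f (Suc (n + 5)) c = conv f (\<lambda>c. a * conv_pow f (n + 3) c + b * conv_pow f (n + 2) c + d * conv_pow f (n + 1) c) c"
    unfolding conv_pow_Suc[of f "n + 5"] using Suc.IH by presburger
  also have "\<dots> = a * conv_pow f (Suc (n + 3)) c + b * conv_pow f (Suc (n + 2)) c + d * conv_pow f (Suc (n + 1)) c"
    unfolding conv_add_right conv_scale_right conv_pow_Suc ..
  finally show ?case
    by simp
qed

section \<open>Convolution powers of the sum of the quartic characters\<close>

context generator_1_mod_4
begin

definition char_comb :: "'b::comm_ring_1 \<Rightarrow> 'b \<Rightarrow> 'b \<Rightarrow> 'b \<Rightarrow> 'b \<Rightarrow> 'b \<Rightarrow> 'a \<Rightarrow> 'b" where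
  "char_comb z a b d k e = (\<lambda>c. a * mchar z c + b * mchar (-1) c + d * mchar (- z) c + k * of_bool (c = 0) + e)"

definition fourth_char :: "'b::comm_ring_1 \<Rightarrow> 'a \<Rightarrow> 'b" where
  "fourth_char z = (\<lambda>c. mchar z c + mchar (-1) c + mchar (- z) c)"

text \<open>The matrix of convolution with \<open>fourth_char z\<close>, from the six products of
  characters. The constant \<open>e\<close> is lost because the characters sum to \<open>0\<close>;
  the delta coefficient \<open>k\<close> reappears at all three characters.\<close>

lemma conv_char_comb:
  fixes z :: "'b::field_char_0"
  assumes "z\<^sup>2 = -1"
  defines "\<epsilon> \<equiv> mchar z (-1)" and "J \<equiv> jacobi z z" and "J' \<equiv> jacobi (- z) (- z)"
  shows "conv (fourth_char z) (char_comb z a b d k e) =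
    char_comb z (\<epsilon> * J' * (b + d) + k) (J * a + J' * d + k) (\<epsilon> * J * (a + b) + k)
      (of_nat CARD('a) * (\<epsilon> * a + b + \<epsilon> * d)) (- (\<epsilon> * a + b + \<epsilon> * d))"
proof
  fix c
  note z = root_power_card[OF assms(1)]
  have z': "(- z)\<^sup>2 = -1"
    using assms(1) by simp
  have nz: "z \<noteq> 1" "- z \<noteq> 1" "z * z = -1" "(-1 :: 'b) \<noteq> 1" "z * - z = 1" "- z * z = 1"
      "z \<noteq> -1"
    using assms(1) by (auto simp: power2_eq_square minus_equation_iff)
  have e: "\<epsilon> * \<epsilon> = 1"
    using mchar_mult[OF z(1), of "-1" "-1"] z(1) by (simp add: \<epsilon>_def)
  have J: "jacobi (-1) z = \<epsilon> * J" "jacobi (-1) (- z) = \<epsilon> * J'"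
    using jacobi_diag[OF assms(1)] jacobi_diag[OF z'] e
    by (simp_all add: J_def J'_def \<epsilon>_def mchar_minus_1_root(2)[OF assms(1)] flip: mult.assoc)
  have 11: "conv (mchar z) (mchar z) c = J * mchar (-1) c"
    using conv_mchar[OF z(1) z(1)] nz by (simp add: J_def)
  have 33: "conv (mchar (- z)) (mchar (- z)) c = J' * mchar (-1) c"
    using conv_mchar[OF z(2) z(2)] nz by (simp add: J'_def)
  have 21: "conv (mchar (-1)) (mchar z) c = \<epsilon> * J * mchar (- z) c"
    using conv_mchar[OF z(3) z(1)] nz by (simp add: J)
  have 23: "conv (mchar (-1)) (mchar (- z)) c = \<epsilon> * J' * mchar z c"
    using conv_mchar[OF z(3) z(2)] nz by (simp add: J)
  have 13: "conv (mchar z) (mchar (- z)) c = \<epsilon> * (of_nat CARD('a) * of_bool (c = 0) - 1)"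
    using conv_mchar_inverse[OF z(1) nz(5,1)]
    by (simp add: \<epsilon>_def mchar_minus_1_root(2)[OF assms(1)])
  have 22: "conv (mchar (-1)) (mchar (-1 :: 'b)) c = of_nat CARD('a) * of_bool (c = 0) - 1"
    using conv_mchar_inverse[OF z(3), of "-1"] nz
    by (simp add: mchar_minus_1_root(3)[OF assms(1)])
  have delta: "conv f (\<lambda>c. of_bool (c = 0)) c = f c" for f :: "'a \<Rightarrow> 'b"
    using conv_delta[of f 1 0 c] by simp
  have const: "conv (mchar w) (\<lambda>c. e) c = 0" if "w ^ (CARD('a) - 1) = 1" "w \<noteq> 1" for w :: 'b
    by (simp add: conv_const_right sum_mchar[OF that])
  show "conv (fourth_char z) (char_comb z a b d k e) c =
    char_comb z (\<epsilon> * J' * (b + d) + k) (J * a + J' * d + k) (\<epsilon> * J * (a + b) + k)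
      (of_nat CARD('a) * (\<epsilon> * a + b + \<epsilon> * d)) (- (\<epsilon> * a + b + \<epsilon> * d)) c"
    unfolding fourth_char_def char_comb_def conv_add_left conv_add_right conv_scale_right
      conv_commute[of "mchar z" "mchar (-1)"] conv_commute[of "mchar (- z)" "mchar z"]
      conv_commute[of "mchar (- z)" "mchar (-1)"] 11 33 21 23 13 22 delta
      const[OF z(1) nz(1)] const[OF z(2) nz(2)] const[OF z(3) nz(4)]
    by (simp add: algebra_simps)
qed

text \<open>Modulo constants that matrix is 4 by 4, and the last relation is its characteristic
  equation, verified directly for both signs of \<open>\<epsilon>\<close>. The final constant makes
  both sides have the same sum over the field.\<close>

lemma conv_pow_fourth_char:
  fixes z :: "'b::field_char_0"
  assumes "z\<^sup>2 = -1"
  defines "\<epsilon> \<equiv> mchar z (-1)" and "J \<equiv> jacobi z z" and "J' \<equiv> jacobi (- z) (- z)"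
    and "q \<equiv> of_nat CARD('a)"
  shows "conv_pow (fourth_char z) 0 = char_comb z 0 0 0 1 0"
    and "conv_pow (fourth_char z) 1 = char_comb z 1 1 1 0 0"
    and "conv_pow (fourth_char z) 2 =
      char_comb z (2 * \<epsilon> * J') (J + J') (2 * \<epsilon> * J) (q * (2 * \<epsilon> + 1)) (- (2 * \<epsilon> + 1))"
    and "conv_pow (fourth_char z) 3 =
      char_comb z (\<epsilon> * J' * (J + J' + 2 * \<epsilon> * J) + q * (2 * \<epsilon> + 1))
        (4 * \<epsilon> * q + q * (2 * \<epsilon> + 1))
        (\<epsilon> * J * (J + J' + 2 * \<epsilon> * J') + q * (2 * \<epsilon> + 1))
        (3 * q * (J + J')) (- 3 * (J + J'))"
    and "conv_pow (fourth_char z) 4 c =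
      (4 * \<epsilon> + 2) * q * conv_pow (fourth_char z) 2 c + 4 * q * (J + J') * conv_pow (fourth_char z) 1 c
      + (q * (J + J')\<^sup>2 - (5 - 4 * \<epsilon>) * q\<^sup>2) * conv_pow (fourth_char z) 0 c
      + ((5 - 4 * \<epsilon>) * q - (J + J')\<^sup>2)"
proof -
  note z = root_power_card[OF assms(1)]
  have e: "\<epsilon> * \<epsilon> = 1"
    using mchar_mult[OF z(1), of "-1" "-1"] z(1) by (simp add: \<epsilon>_def)
  then have e12: "\<epsilon> = 1 \<or> \<epsilon> = -1"
    by (simp add: square_eq_1_iff)
  have JJ: "J * J' = q"
    using jacobi_norm[OF assms(1)] by (simp add: J_def J'_def q_def)
  note cc = conv_char_comb[OF assms(1), folded \<epsilon>_def J_def J'_def q_def]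
  show 0: "conv_pow (fourth_char z) 0 = char_comb z 0 0 0 1 0"
    by (simp add: conv_pow_def char_comb_def)
  show 1: "conv_pow (fourth_char z) 1 = char_comb z 1 1 1 0 0"
    using conv_pow_Suc[of "fourth_char z" 0] unfolding 0 cc by (simp add: One_nat_def)
  show 2: "conv_pow (fourth_char z) 2 =
      char_comb z (2 * \<epsilon> * J') (J + J') (2 * \<epsilon> * J) (q * (2 * \<epsilon> + 1)) (- (2 * \<epsilon> + 1))"
    using conv_pow_Suc[of "fourth_char z" 1] unfolding 1 cc
    by (simp add: numeral_2_eq_2 One_nat_def algebra_simps)
  show 3: "conv_pow (fourth_char z) 3 =
      char_comb z (\<epsilon> * J' * (J + J' + 2 * \<epsilon> * J) + q * (2 * \<epsilon> + 1))
        (4 * \<epsilon> * q + q * (2 * \<epsilon> + 1))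
        (\<epsilon> * J * (J + J' + 2 * \<epsilon> * J') + q * (2 * \<epsilon> + 1))
        (3 * q * (J + J')) (- 3 * (J + J'))"
  proof -
    have "conv_pow (fourth_char z) 3 = conv (fourth_char z) (conv_pow (fourth_char z) 2)"
      using conv_pow_Suc[of "fourth_char z" 2] by simp
    also have "\<dots> = char_comb z (\<epsilon> * J' * (J + J' + 2 * \<epsilon> * J) + q * (2 * \<epsilon> + 1))
        (4 * \<epsilon> * q + q * (2 * \<epsilon> + 1))
        (\<epsilon> * J * (J + J' + 2 * \<epsilon> * J') + q * (2 * \<epsilon> + 1))
        (3 * q * (J + J')) (- 3 * (J + J'))"
      unfolding 2 cc using e12 by (elim disjE) (simp_all add: JJ[symmetric] algebra_simps)
    finally show ?thesis .
  qed
  have "conv_pow (fourth_char z) 4 = conv (fourth_char z) (conv_pow (fourth_char z) 3)"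
    using conv_pow_Suc[of "fourth_char z" 3] by simp
  then show "conv_pow (fourth_char z) 4 c =
      (4 * \<epsilon> + 2) * q * conv_pow (fourth_char z) 2 c + 4 * q * (J + J') * conv_pow (fourth_char z) 1 c
      + (q * (J + J')\<^sup>2 - (5 - 4 * \<epsilon>) * q\<^sup>2) * conv_pow (fourth_char z) 0 c
      + ((5 - 4 * \<epsilon>) * q - (J + J')\<^sup>2)"
    unfolding 3 cc unfolding 0 1 2 char_comb_def using e12
    by (elim disjE) (simp_all add: JJ[symmetric] algebra_simps power2_eq_square)
qed

end

section \<open>Generating functions\<close>

lemma fps_of_poly_pCons_mult_nth:
  fixes F :: "'a::comm_ring_1 fps"
  shows "(fps_of_poly (pCons a p) * F) $ n = a * F $ n + (if n = 0 then 0 else (fps_of_poly p * F) $ (n - 1))"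
proof -
  have "fps_of_poly (pCons a p) * F = fps_const a * F + fps_X * (fps_of_poly p * F)"
    by (simp add: fps_of_poly_pCons algebra_simps)
  then show ?thesis
    by simp
qed

lemma rat_fun_eqI:
  assumes "fps_of_poly b * F = fps_of_poly a" "poly.coeff b 0 \<noteq> 0"
  shows "rat_fun a b = F"
proof -
  have "fps_of_poly b \<noteq> 0"
    using assms(2) by auto
  then show ?thesis
    unfolding rat_fun_def assms(1)[symmetric] by (rule nonzero_mult_div_cancel_left)
qed

text \<open>Degrees up to 4 give the numerator, higher ones the recurrence. Terms with
  \<open>F $ 0\<close> are absent as that coefficient is \<open>0\<close>, so the recurrence begins
  in degree 5.\<close>

lemma rat_fun_quartic_eqI:
  assumes "F $ 0 = 0" "F $ 1 = a" "F $ 2 = b" "F $ 3 + u * F $ 1 = d"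
    and "F $ 4 + u * F $ 2 + v * F $ 1 = e"
    and "\<And>n. F $ (n + 5) + u * F $ (n + 3) + v * F $ (n + 2) + w * F $ (n + 1) = 0"
  shows "rat_fun [:0, a, b, d, e:] [:1, 0, u, v, w:] = F"
proof (rule rat_fun_eqI)
  show "fps_of_poly [:1, 0, u, v, w:] * F = fps_of_poly [:0, a, b, d, e:]"
  proof (rule fps_ext)
    fix n :: nat
    have "n = 0 \<or> n = 1 \<or> n = 2 \<or> n = 3 \<or> n = 4 \<or> n = (n - 5) + 5"
      by arith
    then consider "n = 0" | "n = 1" | "n = 2" | "n = 3" | "n = 4" | k where "n = k + 5"
      by blast
    then show "(fps_of_poly [:1, 0, u, v, w:] * F) $ n = fps_of_poly [:0, a, b, d, e:] $ n"
      using assms(1-5) assms(6)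
      by cases (simp_all add: fps_of_poly_pCons_mult_nth coeff_pCons numeral_eq_Suc One_nat_def add.assoc)
  qed
qed simp

lemma rat_fun_quadratic_eqI:
  assumes "F $ 0 = 0" "F $ 1 = a" "F $ 2 = b" "\<And>n. F $ (n + 3) + u * F $ (n + 1) = 0"
  shows "rat_fun [:0, a, b:] [:1, 0, u:] = F"
proof (rule rat_fun_eqI)
  show "fps_of_poly [:1, 0, u:] * F = fps_of_poly [:0, a, b:]"
  proof (rule fps_ext)
    fix n :: nat
    have "n = 0 \<or> n = 1 \<or> n = 2 \<or> n = (n - 3) + 3"
      by arith
    then consider "n = 0" | "n = 1" | "n = 2" | k where "n = k + 3"
      by blast
    then show "(fps_of_poly [:1, 0, u:] * F) $ n = fps_of_poly [:0, a, b:] $ n"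
      using assms(1-3) assms(4)
      by cases (simp_all add: fps_of_poly_pCons_mult_nth coeff_pCons numeral_eq_Suc One_nat_def add.assoc)
  qed
qed simp

text \<open>The mean count \<open>q^(n-1)\<close> accounts for the fraction
  \<open>x/(1 - qx)\<close>; this series is the rest.\<close>

definition excess :: "'a::{field,finite} \<Rightarrow> rat fps" where
  "excess c = Abs_fps (\<lambda>n. if n = 0 then 0 else of_nat (num_sols n c) - of_nat CARD('a) ^ (n - 1))"

lemma gen_fun_eq_excess:
  fixes c :: "'a::{field,finite}"
  shows "gen_fun c = rat_fun [:0, 1:] [:1, - of_nat CARD('a):] + excess c"
proof -
  define Q :: rat where "Q = of_nat CARD('a)"
  have "rat_fun [:0, 1:] [:1, - Q:] = Abs_fps (\<lambda>n. if n = 0 then 0 else Q ^ (n - 1))"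
  proof (rule rat_fun_eqI)
    show "fps_of_poly [:1, - Q:] * Abs_fps (\<lambda>n. if n = 0 then 0 else Q ^ (n - 1)) = fps_of_poly [:0, 1:]"
    proof (rule fps_ext)
      fix n :: nat
      consider "n = 0" | "n = 1" | k where "n = Suc (Suc k)"
        by (metis One_nat_def nat.exhaust)
      then show "(fps_of_poly [:1, - Q:] * Abs_fps (\<lambda>n. if n = 0 then 0 else Q ^ (n - 1))) $ n
          = fps_of_poly [:0, 1:] $ n"
        by cases (simp_all add: fps_of_poly_pCons_mult_nth coeff_pCons One_nat_def)
    qed
  qed simp
  then show ?thesis
    by (intro fps_ext) (simp add: gen_fun_def excess_def flip: Q_def)
qed

lemma excess_eq_conv_pow:
  fixes f :: "'a::{field,finite} \<Rightarrow> 'b::field_char_0"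
  assumes "\<And>h. (\<Sum>x\<in>UNIV. h (x ^ 4)) = (\<Sum>w\<in>UNIV. h w) + (\<Sum>w\<in>UNIV. f w * h w)"
    and "0 < n"
  shows "of_rat (excess c $ n) = conv_pow f n c"
proof -
  obtain k where "n = Suc k"
    using assms(2) gr0_conv_Suc by blast
  then show ?thesis
    using num_sols_eq_conv_pow[OF assms(1), of k c]
    by (simp add: excess_def of_rat_diff of_rat_power)
qed

section \<open>The generating function for q = 1 mod 4\<close>

context generator_1_mod_4
begin

lemma of_rat_mchar_root:
  "of_rat (of_int (char_re c)) + of_rat (of_int (char_im c)) * \<i> = mchar \<i> c"
  "of_rat (of_int (char_re c)) - of_rat (of_int (char_im c)) * \<i> = mchar (- \<i>) c"
  using mchar_root_eq[of \<i> c] mchar_root_eq[of "- \<i>" c] by simp_all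

text \<open>One formula for all residues of the index and both classes of \<open>q\<close> modulo 8:
  \<open>u\<close>, \<open>v\<close> are the parts of \<open>\<chi>(c)\<close>, \<open>w\<close> is
  \<open>\<chi>^2(c)\<close> and \<open>\<epsilon>\<close> is \<open>\<chi>(-1)\<close>.\<close>

lemma gen_fun_quartic:
  fixes S T \<epsilon> u v w Q :: rat
  assumes "c \<noteq> 0" and ST: "S = - of_int jacobi_re" "2 * T = of_int jacobi_im"
    and Q: "Q = of_nat CARD('a)"
    and \<epsilon>: "\<epsilon> = (-1) ^ ((CARD('a) - 1) div 4)"
    and uvw: "u = of_int (char_re c)" "v = of_int (char_im c)" "w = mchar (-1) c"
  shows "gen_fun c = rat_fun [:0, 1:] [:1, - Q:] +
    rat_fun [:0, 2 * u + w, 4 * \<epsilon> * (2 * T * v - S * u) - 2 * S * w - (2 * \<epsilon> + 1),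
        6 * S - 4 * S * \<epsilon> * (2 * T * v - S * u) + 2 * u * Q * (2 * \<epsilon> + 3) + (6 * \<epsilon> + 1) * Q * w
          - (4 * \<epsilon> + 2) * Q * (2 * u + w),
        (5 - 4 * \<epsilon>) * Q - 4 * S\<^sup>2:]
      [:1, 0, - ((4 * \<epsilon> + 2) * Q), 8 * Q * S, (5 - 4 * \<epsilon>) * Q\<^sup>2 - 4 * Q * S\<^sup>2:]"
proof -
  have i: "\<i>\<^sup>2 = -1" "(- \<i>)\<^sup>2 = -1"
    by auto
  let ?f = "fourth_char \<i>"
  let ?E = "\<lambda>n. conv_pow ?f n c"
  let ?r = "of_rat :: rat \<Rightarrow> complex"
  define J where "J = jacobi \<i> \<i>"
  define J' where "J' = jacobi (- \<i>) (- \<i>)"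
  have f: "(\<Sum>x\<in>UNIV. h (x ^ 4)) = (\<Sum>w\<in>UNIV. h w) + (\<Sum>w\<in>UNIV. ?f w * h w)" for h
    unfolding fourth_char_def by (rule sum_comp_fourth_1_mod_4[OF card_cong i(1)])
  have E: "?r (excess c $ n) = ?E n" if "0 < n" for n
    using f that by (rule excess_eq_conv_pow)
  have f0: "(\<Sum>x\<in>UNIV. ?f x) = 0"
    using f by (rule sum_eq_0_of_sum_comp_fourth)
  have re: "?r S = - of_int jacobi_re" and im: "2 * ?r T = of_int jacobi_im"
    using ST(1) arg_cong[OF ST(2), of ?r] by (simp_all add: of_rat_minus of_rat_mult)
  have J: "J = - ?r S + 2 * ?r T * \<i>" "J' = - ?r S - 2 * ?r T * \<i>"
    unfolding J_def J'_def jacobi_root_eq[OF i(1)] jacobi_root_eq[OF i(2)] im re by simp_all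
  have JJ: "J + J' = - 2 * ?r S"
    by (simp add: J)
  have e: "mchar \<i> (-1) = ?r \<epsilon>"
    by (simp add: mchar_minus_1_root(1)[OF i(1)] \<epsilon> of_rat_power of_rat_minus)
  have q: "of_nat CARD('a) = ?r Q"
    by (simp add: Q)
  have norm: "J * J' = ?r Q"
    unfolding J_def J'_def q[symmetric] by (rule jacobi_norm[OF i(1)])
  have ee: "?r \<epsilon> * ?r \<epsilon> = 1"
    unfolding of_rat_mult[symmetric] \<epsilon> by (simp flip: power_add mult_2)
  have chi: "mchar \<i> c = ?r u + ?r v * \<i>" "mchar (- \<i>) c = ?r u - ?r v * \<i>" "mchar (-1) c = ?r w"
    using of_rat_mchar_root[of c] mchar_minus_1_of_int[where 'b = complex]
    unfolding uvw by (simp_all add: mchar_def of_rat_power of_rat_minus)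
  note cp = conv_pow_fourth_char[OF i(1), folded J_def J'_def, unfolded e q]
  have E1: "?E 1 = ?r (2 * u + w)"
    unfolding cp(2) char_comb_def chi using assms(1) by (simp add: of_rat_add of_rat_mult)
  have E2: "?E 2 = ?r (4 * \<epsilon> * (2 * T * v - S * u) - 2 * S * w - (2 * \<epsilon> + 1))"
    unfolding cp(3) JJ char_comb_def chi J using assms(1)
    by (simp add: of_rat_add of_rat_mult of_rat_diff algebra_simps)
  \<comment> \<open>The norm relation and \<open>\<epsilon>^2 = 1\<close> make the coefficients of
    the third convolution power linear in the Jacobi sums.\<close>
  have a: "?r \<epsilon> * J' * (J + J' + 2 * ?r \<epsilon> * J) = - 2 * ?r S * ?r \<epsilon> * J' + 2 * ?r Q"
  proof -
    have "?r \<epsilon> * J' * (J + J' + 2 * ?r \<epsilon> * J) = (J + J') * ?r \<epsilon> * J' + 2 * (?r \<epsilon> * ?r \<epsilon>) * (J * J')"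
      by (simp add: algebra_simps)
    then show ?thesis
      by (simp add: JJ ee norm)
  qed
  have a': "?r \<epsilon> * J * (J + J' + 2 * ?r \<epsilon> * J') = - 2 * ?r S * ?r \<epsilon> * J + 2 * ?r Q"
  proof -
    have "?r \<epsilon> * J * (J + J' + 2 * ?r \<epsilon> * J') = (J + J') * ?r \<epsilon> * J + 2 * (?r \<epsilon> * ?r \<epsilon>) * (J * J')"
      by (simp add: algebra_simps)
    then show ?thesis
      by (simp add: JJ ee norm)
  qed
  have E3: "?E 3 = ?r (6 * S - 4 * S * \<epsilon> * (2 * T * v - S * u) + 2 * u * Q * (2 * \<epsilon> + 3)
      + (6 * \<epsilon> + 1) * Q * w)"
    unfolding cp(4) a a' unfolding JJ char_comb_def chi J using assms(1)
    by (simp add: of_rat_add of_rat_mult of_rat_diff algebra_simps)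
  have E4: "conv_pow ?f 4 d = (4 * ?r \<epsilon> + 2) * ?r Q * conv_pow ?f 2 d + - 8 * ?r Q * ?r S * conv_pow ?f 1 d
      + (4 * ?r Q * (?r S)\<^sup>2 - (5 - 4 * ?r \<epsilon>) * (?r Q)\<^sup>2) * conv_pow ?f 0 d
      + ((5 - 4 * ?r \<epsilon>) * ?r Q - 4 * (?r S)\<^sup>2)" for d
    unfolding cp(5)[of d] JJ by (simp add: power_mult_distrib)
  have "rat_fun [:0, 2 * u + w, 4 * \<epsilon> * (2 * T * v - S * u) - 2 * S * w - (2 * \<epsilon> + 1),
        6 * S - 4 * S * \<epsilon> * (2 * T * v - S * u) + 2 * u * Q * (2 * \<epsilon> + 3) + (6 * \<epsilon> + 1) * Q * w
          - (4 * \<epsilon> + 2) * Q * (2 * u + w),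
        (5 - 4 * \<epsilon>) * Q - 4 * S\<^sup>2:]
      [:1, 0, - ((4 * \<epsilon> + 2) * Q), 8 * Q * S, (5 - 4 * \<epsilon>) * Q\<^sup>2 - 4 * Q * S\<^sup>2:] = excess c"
  proof (rule rat_fun_quartic_eqI)
    show "excess c $ 0 = 0"
      by (simp add: excess_def)
    show x1: "excess c $ 1 = 2 * u + w"
      using E[of 1] unfolding E1 by simp
    show "excess c $ 2 = 4 * \<epsilon> * (2 * T * v - S * u) - 2 * S * w - (2 * \<epsilon> + 1)"
      using E[of 2] unfolding E2 by simp
    have "excess c $ 3 = 6 * S - 4 * S * \<epsilon> * (2 * T * v - S * u) + 2 * u * Q * (2 * \<epsilon> + 3)
      + (6 * \<epsilon> + 1) * Q * w"
      using E[of 3] unfolding E3 by simp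
    then show "excess c $ 3 + - ((4 * \<epsilon> + 2) * Q) * excess c $ 1 =
        6 * S - 4 * S * \<epsilon> * (2 * T * v - S * u) + 2 * u * Q * (2 * \<epsilon> + 3) + (6 * \<epsilon> + 1) * Q * w
          - (4 * \<epsilon> + 2) * Q * (2 * u + w)"
      by (simp add: x1)
    \<comment> \<open>As \<open>c\<close> is nonzero, the delta term does not enter the coefficient
      of degree 4.\<close>
    have E0: "?E 0 = 0"
      using assms(1) by (simp add: conv_pow_def)
    have "?r (excess c $ 4 + - ((4 * \<epsilon> + 2) * Q) * excess c $ 2 + 8 * Q * S * excess c $ 1)
        = ?r ((5 - 4 * \<epsilon>) * Q - 4 * S\<^sup>2)"
      unfolding of_rat_add of_rat_mult of_rat_diff of_rat_minus of_rat_power of_rat_numeral_eq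
      using E[of 1] E[of 2] E[of 4] by (simp add: E4 E0 of_rat_1 algebra_simps)
    then show "excess c $ 4 + - ((4 * \<epsilon> + 2) * Q) * excess c $ 2 + 8 * Q * S * excess c $ 1
        = (5 - 4 * \<epsilon>) * Q - 4 * S\<^sup>2"
      by (simp only: of_rat_eq_iff)
    fix n :: nat
    have "?r (excess c $ (n + 5) + - ((4 * \<epsilon> + 2) * Q) * excess c $ (n + 3) + 8 * Q * S * excess c $ (n + 2)
        + ((5 - 4 * \<epsilon>) * Q\<^sup>2 - 4 * Q * S\<^sup>2) * excess c $ (n + 1)) = ?r 0"
      unfolding of_rat_add of_rat_mult of_rat_diff of_rat_minus of_rat_power of_rat_numeral_eq of_rat_0
      using E[of "n + 1"] E[of "n + 2"] E[of "n + 3"] E[of "n + 5"]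
        conv_pow_recurrence[OF f0 E4, of n c] by (simp add: algebra_simps)
    then show "excess c $ (n + 5) + - ((4 * \<epsilon> + 2) * Q) * excess c $ (n + 3) + 8 * Q * S * excess c $ (n + 2)
        + ((5 - 4 * \<epsilon>) * Q\<^sup>2 - 4 * Q * S\<^sup>2) * excess c $ (n + 1) = 0"
      by (simp only: of_rat_eq_iff)
  qed
  then show ?thesis
    using gen_fun_eq_excess[of c] by (simp add: Q)
qed

end

section \<open>The generating function for q = 3 mod 4\<close>

context generator
begin

text \<open>The quadratic character is odd, so its convolution square is \<open>1\<close> minus
  \<open>q\<close> times the delta function, and its cube is \<open>-q\<close> times the
  character.\<close>

lemma gen_fun_3_mod_4:
  assumes "[CARD('a) = 3] (mod 4)"
  shows "gen_fun c = rat_fun [:0, 1:] [:1, - of_nat CARD('a):] +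
    rat_fun [:0, mchar (-1) c, 1 - of_nat CARD('a) * of_bool (c = 0):] [:1, 0, of_nat CARD('a):]"
proof -
  let ?f = "mchar (-1 :: rat)"
  let ?q = "of_nat CARD('a) :: rat"
  have odd: "odd CARD('a)" and half: "odd ((CARD('a) - 1) div 2)"
    using assms by (simp_all add: cong_def) presburger+
  have m1: "(-1 :: rat) ^ (CARD('a) - 1) = 1"
    using odd by simp
  have f: "(\<Sum>x\<in>UNIV. h (x ^ 4)) = (\<Sum>w\<in>UNIV. h w) + (\<Sum>w\<in>UNIV. ?f w * h w)" for h :: "'a \<Rightarrow> rat"
    using sum_comp_fourth_3_mod_4[OF assms, of h] by (simp add: distrib_right sum.distrib)
  have E: "excess c $ n = conv_pow ?f n c" if "0 < n" for n
    using excess_eq_conv_pow[OF f that] by simp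
  have f0: "(\<Sum>x\<in>UNIV. ?f x) = 0"
    using f by (rule sum_eq_0_of_sum_comp_fourth)
  have 1: "conv_pow ?f 1 = ?f"
  proof
    fix c
    show "conv_pow ?f 1 c = ?f c"
      using conv_delta[of ?f 1 0 c] conv_pow_Suc[of ?f 0] by (simp add: conv_pow_def One_nat_def)
  qed
  have "conv_pow ?f 2 = conv ?f ?f"
    using conv_pow_Suc[of ?f 1] unfolding 1 by simp
  then have 2: "conv_pow ?f 2 = (\<lambda>c. - ?q * of_bool (c = 0) + 1)"
    using conv_mchar_inverse[OF m1, of "-1"] half by (simp add: mchar_minus_1[OF odd m1])
  have 3: "conv_pow ?f (n + 3) d = - ?q * conv_pow ?f (n + 1) d" for n d
  proof (induction n arbitrary: d)
    case 0
    have "conv_pow ?f 3 d = conv ?f (conv_pow ?f 2) d"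
      using conv_pow_Suc[of ?f 2] by simp
    also have "\<dots> = - ?q * ?f d"
      unfolding 2 conv_delta f0 by simp
    finally show ?case
      by (simp add: 1)
  next
    case (Suc n)
    have "conv_pow ?f (Suc (n + 3)) d = conv ?f (\<lambda>d. - ?q * conv_pow ?f (n + 1) d) d"
      unfolding conv_pow_Suc[of ?f "n + 3"] using Suc.IH by presburger
    also have "\<dots> = - ?q * conv_pow ?f (Suc (n + 1)) d"
      unfolding conv_scale_right conv_pow_Suc ..
    finally show ?case
      by simp
  qed
  have "rat_fun [:0, ?f c, 1 - ?q * of_bool (c = 0):] [:1, 0, ?q:] = excess c"
    by (rule rat_fun_quadratic_eqI)
      (use 3[of _ c] in \<open>simp_all add: E 1 2, simp add: excess_def\<close>)
  then show ?thesis
    using gen_fun_eq_excess[of c] by simp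
qed

end

theorem theorem1p1:
  fixes p m q :: nat and g c :: "'a::{field,finite}"
  assumes "prime p" and "odd p" and "m \<ge> 1" and "q = p ^ m"
    and "CARD('a) = q"
    and "is_generator g"
  shows
    "([q = 1] (mod 4) \<and> c \<noteq> 0 \<longrightarrow>
        (\<exists>!(s, t). is_st p m g s t) \<and>
        (\<forall>s t. is_st p m g s t \<longrightarrow>
          (let Q = of_nat q :: rat; S = of_int s :: rat; T = of_int t :: rat in
            ([q = 1] (mod 8) \<longrightarrow>
              gen_fun c = rat_fun [:0, 1:] [:1, - Q:] +
                rat_fun ([:0, 0, 0, 6*S, Q - 4*S\<^sup>2:] + B1 Q S T (ind g c))
                        [:1, 0, - 6*Q, 8*Q*S, Q\<^sup>2 - 4*Q*S\<^sup>2:]) \<and>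
            ([q = 5] (mod 8) \<longrightarrow>
              gen_fun c = rat_fun [:0, 1:] [:1, - Q:] +
                rat_fun ([:0, 0, 0, 6*S, 9*Q - 4*S\<^sup>2:] + B2 Q S T (ind g c))
                        [:1, 0, 2*Q, 8*Q*S, 9*Q\<^sup>2 - 4*Q*S\<^sup>2:]))))
     \<and>
     ([q = 3] (mod 4) \<longrightarrow>
        (let Q = of_nat q :: rat in
          (c = 0 \<longrightarrow>
            gen_fun c = rat_fun [:0, 1:] [:1, - Q:] + rat_fun [:0, 0, 1 - Q:] [:1, 0, Q:]) \<and>
          (c \<noteq> 0 \<and> (\<exists>y. c = y\<^sup>2) \<longrightarrow>
            gen_fun c = rat_fun [:0, 1:] [:1, - Q:] + rat_fun [:0, 1, 1:] [:1, 0, Q:]) \<and>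
          ((\<nexists>y. c = y\<^sup>2) \<longrightarrow>
            gen_fun c = rat_fun [:0, 1:] [:1, - Q:] + rat_fun [:0, -1, 1:] [:1, 0, Q:])))"
proof (intro conjI impI)
  interpret generator g
    using assms(6) by unfold_locales
  have card: "CARD('a) = p ^ m"
    using assms(4,5) by simp
  show "(\<exists>!(s, t). is_st p m g s t)"
    and "\<forall>s t. is_st p m g s t \<longrightarrow>
          (let Q = of_nat q :: rat; S = of_int s :: rat; T = of_int t :: rat in
            ([q = 1] (mod 8) \<longrightarrow>
              gen_fun c = rat_fun [:0, 1:] [:1, - Q:] +
                rat_fun ([:0, 0, 0, 6*S, Q - 4*S\<^sup>2:] + B1 Q S T (ind g c))
                        [:1, 0, - 6*Q, 8*Q*S, Q\<^sup>2 - 4*Q*S\<^sup>2:]) \<and>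
            ([q = 5] (mod 8) \<longrightarrow>
              gen_fun c = rat_fun [:0, 1:] [:1, - Q:] +
                rat_fun ([:0, 0, 0, 6*S, 9*Q - 4*S\<^sup>2:] + B2 Q S T (ind g c))
                        [:1, 0, 2*Q, 8*Q*S, 9*Q\<^sup>2 - 4*Q*S\<^sup>2:]))"
    if "[q = 1] (mod 4) \<and> c \<noteq> 0"
  proof -
    interpret generator_1_mod_4 g
      using that assms(5) by unfold_locales simp
    have c: "c \<noteq> 0"
      using that by simp
    note st0 = is_st_jacobi[OF assms(1,2) card]
    note unique = is_st_unique[OF assms(1,2) card]
    show "\<exists>!(s, t). is_st p m g s t"
    proof (rule ex1I[of _ "(- jacobi_re, jacobi_im div 2)"])
      show "case (- jacobi_re, jacobi_im div 2) of (s, t) \<Rightarrow> is_st p m g s t"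
        using st0 by simp
    next
      fix x assume "case x of (s, t) \<Rightarrow> is_st p m g s t"
      then show "x = (- jacobi_re, jacobi_im div 2)"
        using unique[OF _ st0] by (cases x) auto
    qed
    show "\<forall>s t. is_st p m g s t \<longrightarrow>
          (let Q = of_nat q :: rat; S = of_int s :: rat; T = of_int t :: rat in
            ([q = 1] (mod 8) \<longrightarrow>
              gen_fun c = rat_fun [:0, 1:] [:1, - Q:] +
                rat_fun ([:0, 0, 0, 6*S, Q - 4*S\<^sup>2:] + B1 Q S T (ind g c))
                        [:1, 0, - 6*Q, 8*Q*S, Q\<^sup>2 - 4*Q*S\<^sup>2:]) \<and>
            ([q = 5] (mod 8) \<longrightarrow>
              gen_fun c = rat_fun [:0, 1:] [:1, - Q:] +
                rat_fun ([:0, 0, 0, 6*S, 9*Q - 4*S\<^sup>2:] + B2 Q S T (ind g c))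
                        [:1, 0, 2*Q, 8*Q*S, 9*Q\<^sup>2 - 4*Q*S\<^sup>2:]))"
    proof (intro allI impI)
      fix s t assume "is_st p m g s t"
      then have s: "s = - jacobi_re" and t: "2 * t = jacobi_im"
        using unique[OF _ st0, of s t] jacobi_re_im_cong(2) by auto
      define Q S T :: rat where QST: "Q = of_nat q" "S = of_int s" "T = of_int t"
      have ST: "S = - of_int jacobi_re" "2 * T = of_int jacobi_im" "Q = of_nat CARD('a)"
        using s arg_cong[OF t, of "of_int :: int \<Rightarrow> rat"] assms(5) by (simp_all add: QST)
      have "int q = s\<^sup>2 + 4 * t\<^sup>2"
        using jacobi_re_im_norm assms(5) by (simp add: s power_mult_distrib flip: t)
      then have "(of_int (int q) :: rat) = of_int (s\<^sup>2 + 4 * t\<^sup>2)"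
        by (rule arg_cong)
      \<comment> \<open>The norm equation eliminates \<open>Q\<close>, so that the listed
        polynomials can be compared as expressions in \<open>S\<close> and \<open>T\<close>
        alone.\<close>
      then have Q: "Q = S\<^sup>2 + 4 * T\<^sup>2"
        by (simp add: QST)
      define r where "r = ind g c"
      have r4: "r mod 4 \<in> {0, 1, 2, 3}"
        by auto
      define u v w :: rat where "u = of_int (char_re c)" and "v = of_int (char_im c)" and "w = mchar (-1) c"
      have uvw: "u = of_int (quarter_cos r)" "v = of_int (quarter_sin r)" "w = (if even r then 1 else -1)"
        using c by (simp_all add: u_def v_def w_def char_re_def char_im_def r_def mchar_def)
      have even_r: "even r \<longleftrightarrow> even (r mod 4)"
        by (simp add: dvd_mod_iff)
      note gf = gen_fun_quartic[OF c ST refl u_def v_def w_def]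
      have "gen_fun c = rat_fun [:0, 1:] [:1, - Q:] +
          rat_fun ([:0, 0, 0, 6*S, Q - 4*S\<^sup>2:] + B1 Q S T r) [:1, 0, - 6*Q, 8*Q*S, Q\<^sup>2 - 4*Q*S\<^sup>2:]"
        if "[q = 1] (mod 8)"
      proof -
        \<comment> \<open>The class of \<open>q\<close> modulo 8 decides the sign
          \<open>\<chi>(-1)\<close>, hence which denominator occurs.\<close>
        have "8 dvd CARD('a) - 1"
          using that assms(5) card_field_ge_2[where 'a = 'a] by (simp add: cong_altdef_nat)
        then have "(-1 :: rat) ^ ((CARD('a) - 1) div 4) = 1"
          by (auto elim!: dvdE)
        note gf = gf[unfolded this]
        show ?thesis
          unfolding gf using r4 unfolding uvw even_r quarter_cos_def quarter_sin_def
          by (elim insertE emptyE) (simp_all add: B1_def cong_def Q power2_eq_square algebra_simps minus_diff_commute)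
      qed
      moreover have "gen_fun c = rat_fun [:0, 1:] [:1, - Q:] +
          rat_fun ([:0, 0, 0, 6*S, 9*Q - 4*S\<^sup>2:] + B2 Q S T r) [:1, 0, 2*Q, 8*Q*S, 9*Q\<^sup>2 - 4*Q*S\<^sup>2:]"
        if "[q = 5] (mod 8)"
      proof -
        have "odd ((CARD('a) - 1) div 4)"
          using that unfolding assms(5)[symmetric] cong_def by presburger
        then have "(-1 :: rat) ^ ((CARD('a) - 1) div 4) = -1"
          by simp
        note gf = gf[unfolded this]
        show ?thesis
          unfolding gf using r4 unfolding uvw even_r quarter_cos_def quarter_sin_def
          by (elim insertE emptyE) (simp_all add: B2_def cong_def Q power2_eq_square algebra_simps minus_diff_commute)
      qed
      ultimately show "let Q = of_nat q :: rat; S = of_int s :: rat; T = of_int t :: rat in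
            ([q = 1] (mod 8) \<longrightarrow>
              gen_fun c = rat_fun [:0, 1:] [:1, - Q:] +
                rat_fun ([:0, 0, 0, 6*S, Q - 4*S\<^sup>2:] + B1 Q S T (ind g c))
                        [:1, 0, - 6*Q, 8*Q*S, Q\<^sup>2 - 4*Q*S\<^sup>2:]) \<and>
            ([q = 5] (mod 8) \<longrightarrow>
              gen_fun c = rat_fun [:0, 1:] [:1, - Q:] +
                rat_fun ([:0, 0, 0, 6*S, 9*Q - 4*S\<^sup>2:] + B2 Q S T (ind g c))
                        [:1, 0, 2*Q, 8*Q*S, 9*Q\<^sup>2 - 4*Q*S\<^sup>2:])"
        unfolding Let_def QST r_def by blast
    qed
  qed
  show "let Q = of_nat q :: rat in
          (c = 0 \<longrightarrow>
            gen_fun c = rat_fun [:0, 1:] [:1, - Q:] + rat_fun [:0, 0, 1 - Q:] [:1, 0, Q:]) \<and>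
          (c \<noteq> 0 \<and> (\<exists>y. c = y\<^sup>2) \<longrightarrow>
            gen_fun c = rat_fun [:0, 1:] [:1, - Q:] + rat_fun [:0, 1, 1:] [:1, 0, Q:]) \<and>
          ((\<nexists>y. c = y\<^sup>2) \<longrightarrow>
            gen_fun c = rat_fun [:0, 1:] [:1, - Q:] + rat_fun [:0, -1, 1:] [:1, 0, Q:])"
    if "[q = 3] (mod 4)"
  proof -
    have odd: "odd CARD('a)"
      using assms(2) card by simp
    \<comment> \<open>A non-square has no square root, so the count forces the character value
      \<open>-1\<close>.\<close>
    have "of_nat (card {x. x\<^sup>2 = c}) = 1 + (mchar (-1) c :: rat)"
      by (rule of_nat_card_sqrt[OF odd])
    then have nonsquare: "mchar (-1) c = (-1 :: rat)" if "\<nexists>y. c = y\<^sup>2"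
      using that by (simp add: eq_commute[of c] eq_neg_iff_add_eq_0 add.commute)
    have square: "mchar (-1) c = (1 :: rat)" if sq: "c \<noteq> 0" "\<exists>y. c = y\<^sup>2"
    proof -
      obtain y where y: "c = y\<^sup>2"
        using sq(2) by blast
      have "mchar (-1 :: rat) (y\<^sup>2) = mchar ((-1)\<^sup>2) y"
        using odd by (intro mchar_square) simp
      then show ?thesis
        using y sq(1) by (auto simp: mchar_one)
    qed
    have "c \<noteq> 0" if "\<nexists>y. c = y\<^sup>2"
      using that by (metis power_zero_numeral)
    then show ?thesis
      using gen_fun_3_mod_4[of c] \<open>[q = 3] (mod 4)\<close> square nonsquare assms(5)
      unfolding Let_def by auto
  qed
qed

end
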